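(* For $m\ge1$ let $F_m(t)=\sum_{r\ge0}b(m^r)t^r$ and $F^*_m(t)=\sum_{r\ge0}b^*(m^r)t^r$, where $b(m^r)$ (resp. $b^*(m^r)$) is the number of alternating (resp. reverse alternating) permutations in $\mathfrak S_{mr}$ of cycle type $\langle m^r\rangle$ (all cycles of length $m$). Then, umbrally: (a) If $m=2^kh$ with $k\ge1$, $h\ge3$, $h$ odd, then $F_m(t)=F^*_m(t)=\left(\frac{1+t}{1-t}\right)^{\frac1{2m}\sum_{d\mid h}\mu(d)E^{m/d}}$. (b) If $m=2^k$ with $k\ge2$, then $F_m(t)=F^*_m(t)=\left(\frac{1+t}{1-t}\right)^{\frac1{2m}(E^m-1)}$. (c) $F_2(t)=\left(\frac{1+t}{1-t}\right)^{(E^2+1)/4}$ and $F_2^*(t)=\frac{F_2(t)}{1+t}$.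
   Context: A permutation $a_1\cdots a_n$ is alternating if $a_1>a_2<a_3>\cdots$ and reverse alternating if $a_1<a_2>a_3<\cdots$. $\mu$ is the Möbius function. Euler numbers $E_n$: $\sum_{n\ge0}E_nx^n/n!=\sec x+\tan x$. An expression $\left(\frac{1+t}{1-t}\right)^{g(E)}$ means $\exp\!\left(g(E)\log\frac{1+t}{1-t}\right)$, expanded as a formal power series in $t$ with coefficients polynomials in an indeterminate $E$; umbral evaluation then expands each coefficient in powers of $E$ and, as the last step, replaces each $E^k$ by $E_k$. *)

theory Defs
  imports
    Complex_Main
    "HOL-Library.Multiset"
    "HOL-Combinatorics.Combinatorics"
    "HOL-Combinatorics.Orbits"
    "HOL-Computational_Algebra.Computational_Algebra"
begin

text \<open>A permutation of \<open>{1..n}\<close> is a function \<open>p\<close> with \<open>p permutes {1..n}\<close>, identified with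
  the word \<open>p 1, p 2, \<dots>, p n\<close>.\<close>

definition alternating :: "nat \<Rightarrow> (nat \<Rightarrow> nat) \<Rightarrow> bool" where
  "alternating n a \<longleftrightarrow>
     (\<forall>i. 1 \<le> i \<and> i < n \<longrightarrow> (if odd i then a i > a (i + 1) else a i < a (i + 1)))"

definition reverse_alternating :: "nat \<Rightarrow> (nat \<Rightarrow> nat) \<Rightarrow> bool" where
  "reverse_alternating n a \<longleftrightarrow>
     (\<forall>i. 1 \<le> i \<and> i < n \<longrightarrow> (if odd i then a i < a (i + 1) else a i > a (i + 1)))"

definition cycle_type :: "(nat \<Rightarrow> nat) \<Rightarrow> nat set \<Rightarrow> nat multiset" where
  "cycle_type p S = image_mset card (mset_set (orbit p ` S))"

definition b_alt :: "nat \<Rightarrow> nat \<Rightarrow> nat" where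
  "b_alt m r = card {p. p permutes {1..m * r} \<and> alternating (m * r) p \<and>
                        cycle_type p {1..m * r} = replicate_mset r m}"

definition b_rev :: "nat \<Rightarrow> nat \<Rightarrow> nat" where
  "b_rev m r = card {p. p permutes {1..m * r} \<and> reverse_alternating (m * r) p \<and>
                        cycle_type p {1..m * r} = replicate_mset r m}"

definition F_alt :: "nat \<Rightarrow> real fps" where
  "F_alt m = Abs_fps (\<lambda>r. real (b_alt m r))"

definition F_rev :: "nat \<Rightarrow> real fps" where
  "F_rev m = Abs_fps (\<lambda>r. real (b_rev m r))"

definition moebius :: "nat \<Rightarrow> int" where
  "moebius n = (if squarefree n then (- 1) ^ card (prime_factors n) else 0)"

text \<open>\<open>\<Sum>\<^sub>n E\<^sub>n x\<^sup>n / n! = sec x + tan x\<close>\<close>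

definition euler_number :: "nat \<Rightarrow> real" where
  "euler_number n = fact n * fps_nth (inverse (fps_cos 1) + fps_tan 1) n"

text \<open>\<open>exp (g log f)\<close> for a series \<open>f\<close> with constant term 1 and a polynomial \<open>g\<close> in the
  indeterminate \<open>E\<close>, as a power series in \<open>t\<close> with coefficients in \<open>\<real>[E]\<close>. The library series
  \<open>fps_ln 1\<close> is \<open>log (1 + t)\<close>; \<open>fps_lift\<close> embeds \<open>\<real>[[t]]\<close> into \<open>\<real>[E][[t]]\<close>.\<close>

definition fps_lift :: "real fps \<Rightarrow> real poly fps" where
  "fps_lift f = Abs_fps (\<lambda>n. [:fps_nth f n:])"

definition fps_log :: "real fps \<Rightarrow> real fps" where
  "fps_log f = fps_ln 1 oo (f - 1)"

definition fps_pow_poly :: "real fps \<Rightarrow> real poly \<Rightarrow> real poly fps" where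
  "fps_pow_poly f g = fps_lift (fps_exp 1) oo (fps_const g * fps_lift (fps_log f))"

definition umbral_eval :: "real poly \<Rightarrow> real" where
  "umbral_eval p = (\<Sum>k\<le>degree p. coeff p k * euler_number k)"

definition umbral :: "real poly fps \<Rightarrow> real fps" where
  "umbral f = Abs_fps (\<lambda>n. umbral_eval (fps_nth f n))"

text \<open>The umbral evaluation of \<open>((1 + t) / (1 - t))\<^bsup>g(E)\<^esup>\<close>\<close>

definition umbral_ratio_pow :: "real poly \<Rightarrow> real fps" where
  "umbral_ratio_pow g = umbral (fps_pow_poly ((1 + fps_X) / (1 - fps_X)) g)"

end

theory Submission
  imports Defs "HOL-Library.List_Lexorder" "HOL-Library.Infinite_Set" "HOL-Library.FuncSet"
begin

text \<open>
  Gessel and Reutenauer: pairs of a permutation \<open>p\<close> of \<open>{1..mr}\<close> with all cycles of length \<open>m\<close> and a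
  weakly increasing word \<open>f\<close> such that \<open>p\<close> increases on every level set of \<open>f\<close> correspond to multisets of
  \<open>r\<close> primitive necklaces of length \<open>m\<close>, with the same multiset of letters. Weight the letter \<open>a\<close> by a
  sign \<open>x\<^sub>a\<close>. For \<open>l\<close> letters the total weight is then a polynomial \<open>H(l, s\<^sup>2)\<close> in \<open>l\<close> and the
  letter sum \<open>s\<close>, because the power sums of the \<open>x\<^sub>a\<close> are \<open>l\<close> and \<open>s\<close>. Averaging over the signs
  leaves the words with all level sets even, and their number for fixed \<open>p\<close> is a binomial coefficient
  \<open>C(l + a, mr/2)\<close>, where \<open>a\<close> counts the ascents of \<open>p\<close> at even positions. As a polynomial in \<open>l\<close> it
  vanishes at \<open>l = -1\<close> unless \<open>a = 0\<close>, that is, unless \<open>p\<close> is reverse alternating. The average of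
  \<open>s\<^sup>n\<close> is \<open>n!\<close> times a coefficient of \<open>cosh\<^sup>l\<close>, so that \<open>l = -1\<close> produces the secant numbers. Alternating
  permutations are treated in the same way by averaging against \<open>x\<^sub>1 x\<^sub>l\<close> and evaluating at \<open>l = 1\<close>.
\<close>

section \<open>Primitive words and the Moebius function\<close>

text \<open>Nothing is counted at \<open>l = -1\<close>: two polynomials in \<open>l\<close> agree
  for all \<open>l \<ge> 2\<close>, hence everywhere. Since \<open>m\<close> is even,
  \<open>m/d\<close> is even for every odd divisor \<open>d\<close>, so only even powers of the
  letter sum \<open>s\<close> occur. Signs are chosen as weights because their power sums depend
  only on the parity of the exponent; so do, then, the power sums of the necklace weights. Newton's
  recursion turns these into the coefficients of a logarithmic derivative in \<open>t\<close>, which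
  therefore alternate between two values. The secant numbers carry signs, which replacing
  \<open>s^2\<close> by \<open>-E^2\<close> absorbs. Pairing each divisor \<open>d\<close> of the
  odd part \<open>h\<close> with \<open>2d\<close> then leaves a value \<open>q\<close> at odd index
  and 0 at even index, except for \<open>m = 2\<close> at \<open>l = -1\<close>. The sum of
  \<open>t^(j-1)\<close> over odd \<open>j\<close> is \<open>1/(1-t^2)\<close>, half the derivative
  of \<open>log((1+t)/(1-t))\<close>. At \<open>l = 1\<close> and \<open>l = -1\<close> the choice
  of \<open>l\<close> affects only a constant multiplied by the sum of \<open>moebius d\<close> over
  \<open>d | h\<close>, and only for \<open>k = 1\<close>. So the two series differ for
  \<open>m = 2\<close> alone, which produces the factor \<open>1 + t\<close>. All comparisons
  precede umbral evaluation, which is linear but not multiplicative.\<close>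

definition primitive_words :: "nat \<Rightarrow> 'a set \<Rightarrow> 'a list set" where
  "primitive_words m A =
     {w. length w = m \<and> set w \<subseteq> A \<and> (\<forall>s. 0 < s \<and> s < m \<longrightarrow> rotate s w \<noteq> w)}"

lemma finite_primitive_words: "finite A \<Longrightarrow> finite (primitive_words m A)"
  by (rule finite_subset[OF _ finite_lists_length_eq[of A m]]) (auto simp: primitive_words_def)

lemma moebius_prime_mult:
  assumes "prime q" "\<not> q dvd d" "d > 0"
  shows "moebius (q * d) = - moebius d"
proof -
  have cop: "coprime q d" using assms(1,2) by (simp add: prime_imp_coprime)
  have sq: "squarefree (q * d) \<longleftrightarrow> squarefree d"
    using cop assms(1) by (auto simp: squarefree_mult_coprime squarefree_prime intro: squarefree_multD)
  have "prime_factors (q * d) = insert q (prime_factors d)"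
    using assms by (subst prime_factors_product) (auto simp: prime_prime_factors)
  moreover have "q \<notin> prime_factors d" using assms(2) by auto
  ultimately show ?thesis by (simp add: moebius_def sq)
qed

text \<open>Divisors pair up as \<open>d\<close> and \<open>q * d\<close> with \<open>d\<close>
  prime to \<open>q\<close>; the others contain \<open>q\<close> twice and have
  \<open>moebius\<close> 0. With \<open>g\<close> constant the pairs cancel, which yields
  \<open>sum_moebius\<close>; with \<open>q = 2\<close> odd and even divisors are separated in
  \<open>signed_cycle_poly_eq\<close>.\<close>

lemma sum_moebius_split:
  fixes g :: "nat \<Rightarrow> 'b::comm_ring_1"
  assumes "n > 0" "prime q" "q dvd n"
  shows "(\<Sum>d | d dvd n. of_int (moebius d) * g d) =
    (\<Sum>d | d dvd n \<and> \<not> q dvd d. of_int (moebius d) * (g d - g (q * d)))"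
proof -
  let ?D = "{d. d dvd n \<and> \<not> q dvd d}"
  have fin: "finite {d. d dvd n}" using assms(1) by simp
  have finD: "finite ?D" by (rule finite_subset[OF _ fin]) auto
  have q0: "q > 0" using assms(2) by (simp add: prime_gt_0_nat)
  have pos: "d > 0" if "d dvd n" for d using that assms(1) by (auto intro: Nat.gr0I)
  have sub: "?D \<union> (*) q ` ?D \<subseteq> {d. d dvd n}"
    using assms(2,3) by (auto intro!: divides_mult simp: prime_imp_coprime)
  have "(\<Sum>d | d dvd n. of_int (moebius d) * g d) =
      (\<Sum>d\<in>?D \<union> (*) q ` ?D. of_int (moebius d) * g d)"
  proof (rule sum.mono_neutral_right[OF fin sub], rule ballI)
    fix d assume d: "d \<in> {d. d dvd n} - (?D \<union> (*) q ` ?D)"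
    then have "q dvd d" by auto
    then obtain e where e: "d = q * e" by auto
    have "e dvd n" using d e by (auto intro: dvd_mult_right)
    then have "q dvd e" using d e by auto
    then have "q\<^sup>2 dvd d" by (simp add: e power2_eq_square)
    moreover have "\<not> is_unit q" using assms(2) by (metis not_prime_unit)
    ultimately have "\<not> squarefree d" by (auto simp: squarefree_def)
    then show "of_int (moebius d) * g d = 0" by (simp add: moebius_def)
  qed
  also have "\<dots> = (\<Sum>d\<in>?D. of_int (moebius d) * g d) + (\<Sum>d\<in>(*) q ` ?D. of_int (moebius d) * g d)"
    by (rule sum.union_disjoint) (use finD in auto)
  also have "(\<Sum>d\<in>(*) q ` ?D. of_int (moebius d) * g d) = (\<Sum>d\<in>?D. of_int (moebius (q * d)) * g (q * d))"
    by (subst sum.reindex) (use q0 in \<open>auto simp: inj_on_def\<close>)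
  also have "\<dots> = (\<Sum>d\<in>?D. - (of_int (moebius d) * g (q * d)))"
    by (rule sum.cong) (use moebius_prime_mult[OF assms(2)] pos in auto)
  finally show ?thesis by (simp add: sum_negf sum_subtractf algebra_simps)
qed

lemma sum_moebius:
  assumes "n > 0"
  shows "(\<Sum>d | d dvd n. of_int (moebius d)) = (if n = 1 then 1 else 0 :: 'b::comm_ring_1)"
proof (cases "n = 1")
  case True
  then have "{d. d dvd n} = {1}" by auto
  then show ?thesis using True by (simp add: moebius_def)
next
  case False
  then obtain q where q: "prime q" "q dvd n" using prime_factor_nat by blast
  show ?thesis
    using sum_moebius_split[OF assms q, of "\<lambda>_. 1 :: 'b"] False by simp
qed

lemma nth_concat_replicate:
  "i < k * length u \<Longrightarrow> concat (replicate k u) ! i = u ! (i mod length u)"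
proof (induction k arbitrary: i)
  case (Suc k)
  show ?case
  proof (cases "i < length u")
    case False
    then have "i - length u < k * length u" using Suc.prems by simp
    then show ?thesis
      using Suc.IH[of "i - length u"] False by (simp add: nth_append le_mod_geq)
  qed (simp add: nth_append)
qed simp

lemma length_concat_replicate: "length (concat (replicate k u)) = k * length u"
  by (induction k) auto

lemma rotate_concat_replicate_iff:
  assumes "k > 0"
  shows "rotate s (concat (replicate k u)) = concat (replicate k u) \<longleftrightarrow> rotate s u = u"
    (is "rotate s ?w = ?w \<longleftrightarrow> _")
proof -
  let ?e = "length u"
  have len: "length ?w = k * ?e" by (rule length_concat_replicate)
  have rw: "rotate s ?w ! i = u ! ((s + i) mod ?e)" if "i < k * ?e" for i
  proof -
    have "(s + i) mod (k * ?e) < k * ?e" using that by (intro mod_less_divisor) linarith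
    then show ?thesis
      using that by (simp add: nth_rotate len nth_concat_replicate mod_mod_cancel)
  qed
  have ru: "rotate s u ! (i mod ?e) = u ! ((s + i) mod ?e)" if "u \<noteq> []" for i
    using that by (simp add: nth_rotate mod_add_right_eq)
  show ?thesis
  proof
    assume h: "rotate s ?w = ?w"
    show "rotate s u = u"
    proof (rule nth_equalityI)
      fix i assume "i < length (rotate s u)"
      then have i: "i < ?e" by simp
      then have "i < k * ?e" using assms by (metis less_le_trans mult_le_mono1 nat_mult_1 One_nat_def Suc_leI)
      then show "rotate s u ! i = u ! i"
        using rw[of i] nth_concat_replicate[of i k u] h i by (simp add: nth_rotate)
    qed simp
  next
    assume h: "rotate s u = u"
    show "rotate s ?w = ?w"
    proof (rule nth_equalityI)
      fix i assume "i < length (rotate s ?w)"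
      then have i: "i < k * ?e" by (simp add: len)
      then have "u \<noteq> []" by auto
      then show "rotate s ?w ! i = ?w ! i"
        using rw[OF i] ru[of i] nth_concat_replicate[OF i] h by simp
    qed simp
  qed
qed

lemma rotate_mult_fixed: "rotate e w = w \<Longrightarrow> rotate (t * e) w = w"
proof (induction t)
  case (Suc t)
  then have "rotate e (rotate (t * e) w) = w" by simp
  then show ?case by (simp add: rotate_rotate)
qed simp

text \<open>Every nonempty word has a unique primitive root. The root's length is the least positive
  rotation that fixes the word, so the length, and then the root as a prefix, can be read off from
  the word.\<close>

lemma bij_betw_primitive_powers:
  assumes m: "m > 0"
  shows "bij_betw (\<lambda>(e, u). concat (replicate (m div e) u))
    (SIGMA e:{e. e dvd m}. primitive_words e A) {w. set w \<subseteq> A \<and> length w = m}"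
    (is "bij_betw ?f ?S ?T")
  unfolding bij_betw_def
proof
  have pos: "e > 0" "m div e > 0" if "e dvd m" for e
    using that m by (auto intro: Nat.gr0I simp: dvd_div_eq_0_iff)
  have least: "e \<le> s" if "e dvd m" "u \<in> primitive_words e A" "s > 0"
    "rotate s (concat (replicate (m div e) u)) = concat (replicate (m div e) u)" for e u s
  proof (rule ccontr)
    assume "\<not> e \<le> s"
    moreover have "rotate s u = u"
      using that(4) rotate_concat_replicate_iff[OF pos(2)[OF that(1)]] by blast
    ultimately show False using that(2,3) by (auto simp: primitive_words_def)
  qed
  have fixd: "rotate e (concat (replicate (m div e) u)) = concat (replicate (m div e) u)"
    if "e dvd m" "u \<in> primitive_words e A" for e u
    using that pos(2) by (subst rotate_concat_replicate_iff) (auto simp: primitive_words_def)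
  have tk: "take e (concat (replicate (m div e) u)) = u"
    if "e dvd m" "u \<in> primitive_words e A" for e u
    using that pos(2)[OF that(1)] by (cases "m div e") (auto simp: primitive_words_def)
  show "inj_on ?f ?S"
  proof (rule inj_onI, clarify)
    fix e u e' u'
    assume a: "e dvd m" "u \<in> primitive_words e A" and b: "e' dvd m" "u' \<in> primitive_words e' A"
      and eq: "concat (replicate (m div e) u) = concat (replicate (m div e') u')"
    have "e \<le> e'" using least[OF a pos(1)[OF b(1)]] fixd[OF b] eq by simp
    moreover have "e' \<le> e" using least[OF b pos(1)[OF a(1)]] fixd[OF a] eq by simp
    ultimately have ee: "e = e'" by simp
    moreover have "u = u'" by (metis tk[OF a] tk[OF b] eq ee)
    ultimately show "e = e' \<and> u = u'" ..
  qed
  show "?f ` ?S = ?T"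
  proof
    show "?f ` ?S \<subseteq> ?T"
      using pos by (auto simp: primitive_words_def length_concat_replicate)
    show "?T \<subseteq> ?f ` ?S"
    proof
      fix w :: "'a list" assume "w \<in> ?T"
      then have w: "set w \<subseteq> A" "m = length w" by auto
      define e where "e = (LEAST e. e > 0 \<and> rotate e w = w)"
      have "m > 0 \<and> rotate m w = w" using m w by simp
      then have e: "e > 0" "rotate e w = w"
        using LeastI[of "\<lambda>e. e > 0 \<and> rotate e w = w" m] unfolding e_def by blast+
      have e_least: "e \<le> s" if "s > 0" "rotate s w = w" for s
        unfolding e_def by (rule Least_le) (use that in simp)
      \<comment> \<open>Otherwise \<open>m mod e\<close> would be a smaller positive rotation fixing
        \<open>w\<close>.\<close>
      have "e dvd m"
      proof (rule ccontr)
        assume "\<not> e dvd m"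
        then have "m mod e > 0" by (simp add: dvd_eq_mod_eq_0)
        moreover have "rotate (m mod e) (rotate (m div e * e) w) = w"
          using w by (simp add: rotate_rotate)
        then have "rotate (m mod e) w = w" using rotate_mult_fixed[OF e(2)] by simp
        ultimately have "e \<le> m mod e" using e_least by blast
        then show False using e(1) by (meson mod_less_divisor not_le)
      qed
      define u where "u = take e w"
      have em: "e \<le> m" using \<open>e dvd m\<close> m by (rule dvd_imp_le)
      have lu: "length u = e" using em w by (simp add: u_def)
      have step: "w ! i = w ! (i mod e)" if "i < m" for i
        using that
      proof (induction i rule: less_induct)
        case (less i)
        show ?case
        proof (cases "i < e")
          case False
          then have "rotate e w ! (i - e) = w ! i"
            using less.prems w by (subst nth_rotate) auto
          then have "w ! i = w ! (i - e)" using e(2) by simp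
          also have "\<dots> = w ! ((i - e) mod e)"
            using less.IH[of "i - e"] less.prems e(1) False by simp
          finally show ?thesis using False by (simp add: le_mod_geq)
        qed simp
      qed
      have wu: "w = concat (replicate (m div e) u)"
      proof (rule nth_equalityI)
        show "length w = length (concat (replicate (m div e) u))"
          using w \<open>e dvd m\<close> by (simp add: length_concat_replicate lu)
        fix i assume "i < length w"
        moreover from this have "i < m div e * length u" using \<open>e dvd m\<close> w lu by simp
        ultimately show "w ! i = concat (replicate (m div e) u) ! i"
          using step[of i] e(1) w by (simp add: nth_concat_replicate lu) (simp add: u_def)
      qed
      have "u \<in> primitive_words e A"
        unfolding primitive_words_def
      proof (intro CollectI conjI allI impI)
        show "set u \<subseteq> A" using w(1) set_take_subset[of e w] by (auto simp: u_def)
        fix s assume s: "0 < s \<and> s < e"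
        show "rotate s u \<noteq> u"
        proof
          assume "rotate s u = u"
          then have "rotate s w = w"
            using rotate_concat_replicate_iff[OF pos(2)[OF \<open>e dvd m\<close>]] wu by metis
          then show False using e_least[of s] s by simp
        qed
      qed (rule lu)
      then show "w \<in> ?f ` ?S"
        using wu \<open>e dvd m\<close> by (intro image_eqI[of _ _ "(e, u)"]) auto
    qed
  qed
qed

lemma sum_words:
  fixes x :: "'a \<Rightarrow> 'b::comm_semiring_1"
  assumes "finite A"
  shows "(\<Sum>w | set w \<subseteq> A \<and> length w = m. prod_list (map x w)) = (\<Sum>a\<in>A. x a) ^ m"
proof (induction m)
  case 0
  have "{w. set w \<subseteq> A \<and> length w = 0} = {[]}" by auto
  then show ?case by simp
next
  case (Suc m)
  let ?T = "{w. set w \<subseteq> A \<and> length w = m}"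
  have "(\<Sum>w | set w \<subseteq> A \<and> length w = Suc m. prod_list (map x w)) =
      (\<Sum>(a, w)\<in>A \<times> ?T. prod_list (map x (a # w)))"
    by (rule sum.reindex_bij_witness[of _ "\<lambda>(a, w). a # w" "\<lambda>w. (hd w, tl w)"])
      (auto simp: length_Suc_conv)
  also have "\<dots> = (\<Sum>a\<in>A. x a) * (\<Sum>w\<in>?T. prod_list (map x w))"
    by (simp add: sum_product sum.cartesian_product)
  finally show ?case using Suc by simp
qed

text \<open>Moebius inversion of \<open>pe\<close>, which sorts all words by primitive root. A root
  of length \<open>e\<close> enters a word of length \<open>n\<close> with exponent multiplied by
  \<open>n div e\<close>, so the identity has to be inverted for all exponents \<open>j\<close>
  together.\<close>

lemma sum_primitive_words:
  fixes x :: "'a \<Rightarrow> real"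
  assumes A: "finite A" and m: "m > 0"
  shows "(\<Sum>w\<in>primitive_words m A. prod_list (map x w) ^ j) =
    (\<Sum>d | d dvd m. of_int (moebius d) * (\<Sum>a\<in>A. x a ^ (j * d)) ^ (m div d))"
proof -
  define Q where "Q e j = (\<Sum>w\<in>primitive_words e A. prod_list (map x w) ^ j)" for e j
  have pw: "prod_list (map (\<lambda>a. x a ^ j) w) = prod_list (map x w) ^ j" for j w
    by (induction w) (simp_all add: power_mult_distrib)
  have pc: "prod_list (map x (concat (replicate k u))) = prod_list (map x u) ^ k" for k u
    by (induction k) simp_all
  have pe: "(\<Sum>a\<in>A. x a ^ j) ^ n = (\<Sum>e | e dvd n. Q e (j * (n div e)))" if n: "n > 0" for n j
  proof -
    have "(\<Sum>a\<in>A. x a ^ j) ^ n = (\<Sum>w | set w \<subseteq> A \<and> length w = n. prod_list (map x w) ^ j)"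
      by (subst sum_words[OF A, symmetric]) (simp add: pw)
    also have "\<dots> = (\<Sum>(e, u)\<in>(SIGMA e:{e. e dvd n}. primitive_words e A).
        prod_list (map x (concat (replicate (n div e) u))) ^ j)"
      by (subst sum.reindex_bij_betw[OF bij_betw_primitive_powers[OF n], symmetric])
        (simp add: case_prod_unfold)
    also have "\<dots> = (\<Sum>e | e dvd n. Q e (j * (n div e)))"
      unfolding Q_def
      by (subst sum.Sigma[symmetric])
        (use n finite_primitive_words[OF A] in \<open>auto simp: pc power_mult mult.commute[of j] simp flip: power_mult\<close>)
    finally show ?thesis .
  qed
  have fin: "finite {d. d dvd m}" using m by simp
  have pos: "e > 0" "m div e > 0" if "e dvd m" for e
    using that m by (auto intro: Nat.gr0I simp: dvd_div_eq_0_iff)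
  have "(\<Sum>d | d dvd m. of_int (moebius d) * (\<Sum>a\<in>A. x a ^ (j * d)) ^ (m div d)) =
      (\<Sum>d | d dvd m. \<Sum>e | e dvd m \<and> d * e dvd m. of_int (moebius d) * Q e (j * (m div e)))"
  proof (rule sum.cong[OF refl])
    fix d assume "d \<in> {d. d dvd m}"
    then have d: "d dvd m" by simp
    have S: "{e. e dvd m div d} = {e. e dvd m \<and> d * e dvd m}"
      using d pos[OF d] by (auto simp: dvd_div_iff_mult mult.commute dest: dvd_mult_left)
    have "j * d * (m div d div e) = j * (m div e)" if "e dvd m div d" for e
    proof -
      from that obtain c where "m div d = e * c" by (rule dvdE)
      then have mm: "m = d * e * c" using d by (metis dvd_mult_div_cancel mult.assoc)
      then have "d > 0" "e > 0" using m by auto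
      then show ?thesis using mm by (simp add: mult.assoc mult.left_commute[of d])
    qed
    then have "(\<Sum>a\<in>A. x a ^ (j * d)) ^ (m div d) = (\<Sum>e | e dvd m div d. Q e (j * (m div e)))"
      by (subst pe[OF pos(2)[OF d]]) (intro sum.cong refl, metis mem_Collect_eq)
    then show "of_int (moebius d) * (\<Sum>a\<in>A. x a ^ (j * d)) ^ (m div d) =
        (\<Sum>e | e dvd m \<and> d * e dvd m. of_int (moebius d) * Q e (j * (m div e)))"
      by (simp add: S sum_distrib_left)
  qed
  also have "\<dots> = (\<Sum>e | e dvd m. \<Sum>d | d dvd m \<and> d * e dvd m. of_int (moebius d) * Q e (j * (m div e)))"
    using sum.swap_restrict[OF fin fin, of "\<lambda>d e. of_int (moebius d) * Q e (j * (m div e))"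
        "\<lambda>d e. d * e dvd m"] by simp
  \<comment> \<open>For fixed \<open>e\<close> the admissible \<open>d\<close> are the divisors of
    \<open>m div e\<close>, so their Moebius sum vanishes unless \<open>e = m\<close>.\<close>
  also have "\<dots> = (\<Sum>e | e dvd m. if e = m then Q m j else 0)"
  proof (rule sum.cong[OF refl])
    fix e assume "e \<in> {d. d dvd m}"
    then have e: "e dvd m" by simp
    have S: "{d. d dvd m \<and> d * e dvd m} = {d. d dvd m div e}"
      using e pos[OF e] by (auto simp: dvd_div_iff_mult dest: dvd_mult_left)
    have iff: "m div e = 1 \<longleftrightarrow> e = m" using e m by (auto elim!: dvdE)
    have "(\<Sum>d | d dvd m \<and> d * e dvd m. of_int (moebius d) * Q e (j * (m div e))) =
        (\<Sum>d | d dvd m div e. of_int (moebius d)) * Q e (j * (m div e))"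
      by (simp add: S sum_distrib_right)
    also have "\<dots> = (if e = m then Q m j else 0)"
      unfolding sum_moebius[OF pos(2)[OF e]] iff using m by simp
    finally show "(\<Sum>d | d dvd m \<and> d * e dvd m. of_int (moebius d) * Q e (j * (m div e))) =
        (if e = m then Q m j else 0)" .
  qed
  also have "\<dots> = Q m j" using fin by simp
  finally show ?thesis by (simp add: Q_def)
qed

section \<open>The Gessel-Reutenauer correspondence\<close>

text \<open>Cycle lengths are phrased through iterates because applying \<open>p\<close> rotates the
  itinerary of a point: this form translates directly into the period condition of
  \<open>primitive_words\<close>.\<close>

definition uniform_cycles :: "nat \<Rightarrow> 'a set \<Rightarrow> ('a \<Rightarrow> 'a) \<Rightarrow> bool" where
  "uniform_cycles m I p \<longleftrightarrow> (\<forall>i\<in>I. (p ^^ m) i = i \<and> (\<forall>s. 0 < s \<and> s < m \<longrightarrow> (p ^^ s) i \<noteq> i))"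

lemma card_orbit_eq_iff:
  assumes "permutation p" "m > 0"
  shows "card (orbit p i) = m \<longleftrightarrow> (p ^^ m) i = i \<and> (\<forall>s. 0 < s \<and> s < m \<longrightarrow> (p ^^ s) i \<noteq> i)"
proof -
  have io: "i \<in> orbit p i"
    by (rule permutation_self_in_orbit[OF assms(1)])
  define d where "d = funpow_dist1 p i i"
  have d: "(p ^^ d) i = i" "d > 0"
    using funpow_dist1_prop[OF io] by (auto simp: d_def)
  have least: "(p ^^ s) i \<noteq> i" if "0 < s" "s < d" for s
    using funpow_dist1_least[of s p i i] that by (auto simp: d_def)
  have "orbit p i = (\<lambda>s. (p ^^ s) i) ` {0..<d}"
    unfolding d_def by (rule orbit_conv_funpow_dist1[OF io])
  moreover have "inj_on (\<lambda>s. (p ^^ s) i) {0..<d}"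
    unfolding d_def by (rule inj_on_funpow_dist1[OF io])
  ultimately have cd: "card (orbit p i) = d"
    by (simp add: card_image)
  show ?thesis
  proof
    assume "card (orbit p i) = m"
    then show "(p ^^ m) i = i \<and> (\<forall>s. 0 < s \<and> s < m \<longrightarrow> (p ^^ s) i \<noteq> i)"
      using d least cd by auto
  next
    assume h: "(p ^^ m) i = i \<and> (\<forall>s. 0 < s \<and> s < m \<longrightarrow> (p ^^ s) i \<noteq> i)"
    then have "\<not> m < d" "\<not> d < m"
      using least[of m] d assms(2) by auto
    then show "card (orbit p i) = m" using cd by simp
  qed
qed

lemma orbit_eq_or_disjoint:
  assumes "permutation p"
  shows "orbit p i = orbit p j \<or> orbit p i \<inter> orbit p j = {}"
proof (rule ccontr)
  assume c: "\<not> ?thesis"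
  then obtain x where x: "x \<in> orbit p i" "x \<in> orbit p j" by auto
  have "orbit p i = orbit p x" "orbit p j = orbit p x"
    using orbit_cyclic_eq3[OF cyclic_on_orbit'[OF assms] x(1)]
      orbit_cyclic_eq3[OF cyclic_on_orbit'[OF assms] x(2)] by simp_all
  then show False using c by simp
qed

text \<open>The multiset also records the number of cycles, but disjoint orbits of size
  \<open>m\<close> covering \<open>m * r\<close> points are necessarily \<open>r\<close> in
  number.\<close>

lemma cycle_type_uniform_iff:
  assumes "p permutes {1..m * r}" "m > 0"
  shows "cycle_type p {1..m * r} = replicate_mset r m \<longleftrightarrow> uniform_cycles m {1..m * r} p"
proof -
  define I where "I = {1..m * r}"
  have pI: "p permutes I" and perm: "permutation p"
    using assms(1) by (auto simp: I_def permutation_permutes)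
  have fin: "finite (orbit p ` I)" by (simp add: I_def)
  have uni: "uniform_cycles m I p \<longleftrightarrow> (\<forall>i\<in>I. card (orbit p i) = m)"
    by (simp add: uniform_cycles_def card_orbit_eq_iff[OF perm assms(2)])
  have "cycle_type p I = replicate_mset r m \<longleftrightarrow> (\<forall>i\<in>I. card (orbit p i) = m)"
  proof
    assume "cycle_type p I = replicate_mset r m"
    then have "set_mset (cycle_type p I) \<subseteq> {m}"
      by auto
    then show "\<forall>i\<in>I. card (orbit p i) = m"
      using fin by (auto simp: cycle_type_def)
  next
    assume h: "\<forall>i\<in>I. card (orbit p i) = m"
    have sub: "orbit p i \<subseteq> I" if "i \<in> I" for i
      using permutes_orbit_subset[OF pI that] .
    have U: "\<Union> (orbit p ` I) = I"
      using sub permutation_self_in_orbit[OF perm] by blast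
    have "m * card (orbit p ` I) = card (\<Union> (orbit p ` I))"
    proof (rule card_partition)
      show "finite (orbit p ` I)" by (rule fin)
      show "finite (\<Union> (orbit p ` I))" by (simp add: U) (simp add: I_def)
    qed (use h orbit_eq_or_disjoint[OF perm] in auto)
    then have "m * card (orbit p ` I) = m * r" by (simp add: U) (simp add: I_def)
    then have c: "card (orbit p ` I) = r" using assms(2) by simp
    have "cycle_type p I = image_mset (\<lambda>_. m) (mset_set (orbit p ` I))"
      unfolding cycle_type_def by (rule image_mset_cong) (use h fin in auto)
    then show "cycle_type p I = replicate_mset r m"
      using c by (simp add: image_mset_const_eq)
  qed
  then show ?thesis using uni by (simp add: I_def)
qed

text \<open>A multiset of \<open>r\<close> necklaces is represented by listing all \<open>m\<close>
  rotations of each one. Invariance under \<open>rotate1\<close> says that multiplicities are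
  constant on rotation classes, so no representatives need to be chosen.\<close>

definition necklace_msets :: "nat \<Rightarrow> 'a set \<Rightarrow> nat \<Rightarrow> 'a list multiset set" where
  "necklace_msets m A r =
     {M. set_mset M \<subseteq> primitive_words m A \<and> image_mset rotate1 M = M \<and> size M = m * r}"

definition gr_pairs :: "nat \<Rightarrow> 'a::linorder set \<Rightarrow> nat \<Rightarrow> ((nat \<Rightarrow> nat) \<times> (nat \<Rightarrow> 'a)) set" where
  "gr_pairs m A r = {(p, f). p permutes {1..m * r} \<and> uniform_cycles m {1..m * r} p \<and>
      f \<in> {1..m * r} \<rightarrow>\<^sub>E A \<and> mono_on {1..m * r} f \<and>
      (\<forall>i\<in>{1..m * r}. \<forall>j\<in>{1..m * r}. i < j \<and> f i = f j \<longrightarrow> p i < p j)}"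

text \<open>The length \<open>k\<close> is kept apart from the cycle length so that the
  lexicographic comparison in \<open>itinerary_mono\<close> can go by induction on it.\<close>

definition itinerary :: "nat \<Rightarrow> (nat \<Rightarrow> nat) \<Rightarrow> (nat \<Rightarrow> 'a) \<Rightarrow> nat \<Rightarrow> 'a list" where
  "itinerary k p f i = map (\<lambda>s. f ((p ^^ s) i)) [0..<k]"

definition gr_mset :: "nat \<Rightarrow> nat \<Rightarrow> (nat \<Rightarrow> nat) \<times> (nat \<Rightarrow> 'a) \<Rightarrow> 'a list multiset" where
  "gr_mset m r = (\<lambda>(p, f). image_mset (itinerary m p f) (mset_set {1..m * r}))"

lemma itinerary_Suc: "itinerary (Suc k) p f i = f i # itinerary k p f (p i)"
proof -
  have "map (\<lambda>s. f ((p ^^ s) i)) [0..<Suc k] = f i # map (\<lambda>s. f ((p ^^ Suc s) i)) [0..<k]"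
    by (simp only: map_upt_Suc) simp
  then show ?thesis
    by (simp add: itinerary_def funpow_swap1)
qed

lemma length_itinerary [simp]: "length (itinerary k p f i) = k"
  by (simp add: itinerary_def)

text \<open>Both maps send the sorted list of \<open>A\<close> to the sorted list of the common
  image. This makes \<open>p\<close> recoverable, since it increases on sets whose images are
  known.\<close>

lemma strict_mono_bij_unique:
  fixes g h :: "'a::linorder \<Rightarrow> 'b::linorder"
  assumes "finite A" "strict_mono_on A g" "strict_mono_on A h" "g ` A = h ` A" "x \<in> A"
  shows "g x = h x"
proof -
  have *: "map k (sorted_list_of_set A) = sorted_list_of_set (k ` A)"
    if "strict_mono_on A k" for k :: "'a \<Rightarrow> 'b"
  proof (rule sorted_distinct_set_unique)
    have inj: "inj_on k A" using that by (rule strict_mono_on_imp_inj_on)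
    show "distinct (map k (sorted_list_of_set A))"
      using inj assms(1) by (simp add: distinct_map)
    have "sorted_wrt (<) (sorted_list_of_set A)" by simp
    then have "sorted_wrt (\<lambda>x y. k x \<le> k y) (sorted_list_of_set A)"
      by (rule sorted_wrt_mono_rel[rotated])
        (use that assms(1) in \<open>auto simp: strict_mono_on_def less_imp_le\<close>)
    then show "sorted (map k (sorted_list_of_set A))"
      by (simp add: sorted_wrt_map)
  qed (use assms(1) in auto)
  have "map g (sorted_list_of_set A) = map h (sorted_list_of_set A)"
    using *[OF assms(2)] *[OF assms(3)] assms(4) by simp
  then show ?thesis using assms(1,5) by simp
qed

lemma rotate1_eq_iff: "rotate1 u = rotate1 v \<longleftrightarrow> u = v"
  by (cases u; cases v) auto

context
  fixes m r :: nat and p :: "nat \<Rightarrow> nat" and f :: "nat \<Rightarrow> 'a::linorder" and A :: "'a set"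
  assumes m: "m > 0" and pf: "(p, f) \<in> gr_pairs m A r"
begin

lemma gr_facts:
  shows "p permutes {1..m * r}" "uniform_cycles m {1..m * r} p" "f \<in> {1..m * r} \<rightarrow>\<^sub>E A"
    "\<And>i j. i \<in> {1..m * r} \<Longrightarrow> j \<in> {1..m * r} \<Longrightarrow> i \<le> j \<Longrightarrow> f i \<le> f j"
    "\<And>i j. i \<in> {1..m * r} \<Longrightarrow> j \<in> {1..m * r} \<Longrightarrow> i < j \<Longrightarrow> f i = f j \<Longrightarrow> p i < p j"
  using pf by (auto simp: gr_pairs_def mono_on_def)

lemma gr_funpow_in: "i \<in> {1..m * r} \<Longrightarrow> (p ^^ s) i \<in> {1..m * r}"
  using permutes_in_image[OF permutes_funpow[OF gr_facts(1)]] by blast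

lemma gr_period: "i \<in> {1..m * r} \<Longrightarrow> (p ^^ m) i = i"
  using gr_facts(2) by (auto simp: uniform_cycles_def)

lemma itinerary_step:
  assumes "i \<in> {1..m * r}"
  shows "itinerary m p f (p i) = rotate1 (itinerary m p f i)"
proof -
  obtain k where k: "m = Suc k" using m by (cases m) auto
  have "itinerary m p f (p i) = itinerary k p f (p i) @ [f ((p ^^ k) (p i))]"
    by (simp add: k itinerary_def)
  also have "(p ^^ k) (p i) = i"
    using gr_period[OF assms] by (simp add: k funpow_swap1)
  finally show ?thesis
    by (simp add: k itinerary_Suc)
qed

lemma itinerary_funpow:
  "i \<in> {1..m * r} \<Longrightarrow> itinerary m p f ((p ^^ s) i) = rotate s (itinerary m p f i)"
proof (induction s)
  case (Suc s)
  then show ?case using itinerary_step[OF gr_funpow_in[of i s]] by simp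
qed simp

text \<open>If the first letters tie, the defining condition of \<open>gr_pairs\<close> gives
  \<open>p i < p j\<close>, and the tails are the itineraries of these two points.\<close>

lemma itinerary_mono:
  "i \<in> {1..m * r} \<Longrightarrow> j \<in> {1..m * r} \<Longrightarrow> i \<le> j \<Longrightarrow> itinerary k p f i \<le> itinerary k p f j"
proof (induction k arbitrary: i j)
  case 0
  then show ?case by (simp add: itinerary_def)
next
  case (Suc k)
  have "p i \<in> {1..m * r}" "p j \<in> {1..m * r}"
    using Suc.prems gr_funpow_in[of _ 1] by auto
  moreover have "f i \<le> f j" using Suc.prems gr_facts(4) by blast
  moreover have "p i \<le> p j" if "f i = f j"
    using gr_facts(5)[OF Suc.prems(1,2)] that Suc.prems(3) by (cases "i = j") auto
  ultimately show ?case
    using Suc.IH[of "p i" "p j"] by (auto simp: itinerary_Suc)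
qed

text \<open>Equal itineraries mean that \<open>f\<close> ties at every stage, so every application
  of \<open>p\<close> preserves the order of the two points.\<close>

lemma itinerary_tie:
  assumes "i \<in> {1..m * r}" "j \<in> {1..m * r}" "i < j" "itinerary m p f i = itinerary m p f j"
  shows "(p ^^ s) i < (p ^^ s) j"
proof (induction s)
  case (Suc s)
  have "itinerary m p f ((p ^^ s) i) = itinerary m p f ((p ^^ s) j)"
    using assms by (simp only: itinerary_funpow)
  then have "f ((p ^^ s) i) = f ((p ^^ s) j)"
    using m by (cases m) (auto simp: itinerary_Suc)
  then show ?case
    using gr_facts(5)[OF gr_funpow_in gr_funpow_in Suc.IH] assms(1,2) by simp
qed (use assms in simp)

text \<open>If rotation by \<open>s\<close> fixed the itinerary, then \<open>i\<close> and its image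
  under \<open>p ^^ s\<close> would be distinct points with equal itineraries. By
  \<open>itinerary_tie\<close> the iterates of \<open>p ^^ s\<close> would move strictly in one
  direction forever, although the \<open>m\<close>-th of them is back at \<open>i\<close>.\<close>

lemma itinerary_primitive:
  assumes i: "i \<in> {1..m * r}"
  shows "itinerary m p f i \<in> primitive_words m A"
proof -
  have "rotate s (itinerary m p f i) \<noteq> itinerary m p f i" if s: "0 < s" "s < m" for s
  proof
    assume eq: "rotate s (itinerary m p f i) = itinerary m p f i"
    define j where "j t = (p ^^ (s * t)) i" for t
    have j_in: "j t \<in> {1..m * r}" for t
      unfolding j_def by (rule gr_funpow_in[OF i])
    have j_Suc: "j (Suc t) = (p ^^ s) (j t)" for t
      by (simp add: j_def funpow_add)
    have jm: "j m = i"
    proof -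
      have "(p ^^ (s * m)) i = i" for s
        by (induction s) (simp_all add: funpow_add gr_period[OF i])
      then show ?thesis by (simp add: j_def)
    qed
    have jt: "itinerary m p f (j t) = itinerary m p f i" for t
      by (induction t) (simp_all add: j_Suc itinerary_funpow[OF j_in] eq, simp add: j_def)
    have j1: "j 1 \<noteq> i" using gr_facts(2) i s by (auto simp: j_def uniform_cycles_def)
    have j0: "j 0 = i" by (simp add: j_def)
    show False
    proof (cases "i < j 1")
      case True
      have "j t < j (Suc t)" for t
      proof (induction t)
        case (Suc t)
        have "(p ^^ s) (j t) < (p ^^ s) (j (Suc t))"
          by (rule itinerary_tie[OF j_in j_in Suc.IH]) (simp add: jt)
        then show ?case by (simp only: j_Suc[symmetric])
      qed (use True j0 in simp)
      then have "j 0 < j m" using lift_Suc_mono_less[of j 0 m] m by blast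
      then show False using jm j0 by simp
    next
      case False
      have dec: "j (Suc t) < j t" for t
      proof (induction t)
        case (Suc t)
        have "(p ^^ s) (j (Suc t)) < (p ^^ s) (j t)"
          by (rule itinerary_tie[OF j_in j_in Suc.IH]) (simp add: jt)
        then show ?case by (simp only: j_Suc[symmetric])
      qed (use False j1 j0 in simp)
      have "j t + t \<le> j 0" for t
      proof (induction t)
        case (Suc t)
        then show ?case using dec[of t] by simp
      qed simp
      from this[of m] show False using jm j0 m by simp
    qed
  qed
  moreover have "set (itinerary m p f i) \<subseteq> A"
    using gr_facts(3) gr_funpow_in[OF i] by (auto simp: itinerary_def)
  ultimately show ?thesis by (auto simp: primitive_words_def)
qed

lemma gr_mset_in: "gr_mset m r (p, f) \<in> necklace_msets m A r"
proof -
  have "image_mset rotate1 (gr_mset m r (p, f)) =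
      image_mset (\<lambda>i. itinerary m p f (p i)) (mset_set {1..m * r})"
    by (auto simp: gr_mset_def multiset.map_comp intro!: image_mset_cong simp: itinerary_step)
  also have "\<dots> = image_mset (itinerary m p f) (image_mset p (mset_set {1..m * r}))"
    by (simp add: multiset.map_comp o_def)
  also have "image_mset p (mset_set {1..m * r}) = mset_set {1..m * r}"
    using permutes_image_mset[OF gr_facts(1)] permutes_image[OF gr_facts(1)]
      permutes_inj_on[OF gr_facts(1)] by (simp add: image_mset_mset_set)
  finally have "image_mset rotate1 (gr_mset m r (p, f)) = gr_mset m r (p, f)"
    by (simp add: gr_mset_def)
  then show ?thesis
    using itinerary_primitive by (auto simp: necklace_msets_def gr_mset_def)
qed

text \<open>Itineraries increase with the starting point, so the multiset alone determines which
  word sits at which position.\<close>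

lemma itinerary_sorted:
  "map (itinerary m p f) [1..<m * r + 1] = sorted_list_of_multiset (gr_mset m r (p, f))"
proof -
  have "sorted_wrt (<) [1..<m * r + 1]" by (rule sorted_wrt_upt)
  then have "sorted_wrt (\<lambda>i j. itinerary m p f i \<le> itinerary m p f j) [1..<m * r + 1]"
    by (rule sorted_wrt_mono_rel[rotated]) (auto intro!: itinerary_mono)
  then have "sorted (map (itinerary m p f) [1..<m * r + 1])"
    by (simp only: sorted_wrt_map)
  moreover have "mset (map (itinerary m p f) [1..<m * r + 1]) = gr_mset m r (p, f)"
  proof -
    have "mset [1..<m * r + 1] = mset_set {1..m * r}"
      by (metis Suc_eq_plus1 atLeastLessThanSuc_atLeastAtMost mset_upt)
    then show ?thesis by (simp add: gr_mset_def)
  qed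
  ultimately show ?thesis
    by (metis sorted_list_of_multiset_mset sorted_sort_id)
qed

lemma gr_fibre_image:
  assumes "i \<in> {1..m * r}" "F = {j \<in> {1..m * r}. itinerary m p f j = itinerary m p f i}"
  shows "strict_mono_on F p"
    "p ` F = {j \<in> {1..m * r}. itinerary m p f j = rotate1 (itinerary m p f i)}"
proof -
  show "strict_mono_on F p"
    unfolding strict_mono_on_def using itinerary_tie[of _ _ 1] assms(2) by auto
  have "j \<in> p ` F" if j: "j \<in> {1..m * r}" "itinerary m p f j = rotate1 (itinerary m p f i)" for j
  proof -
    obtain k where k: "k \<in> {1..m * r}" "j = p k"
      using j(1) permutes_image[OF gr_facts(1)] by (metis imageE)
    then have "rotate1 (itinerary m p f k) = rotate1 (itinerary m p f i)"
      using itinerary_step j(2) by simp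
    then show ?thesis using k assms(2) by (simp add: rotate1_eq_iff)
  qed
  moreover have "p j \<in> {1..m * r}" "itinerary m p f (p j) = rotate1 (itinerary m p f i)"
    if "j \<in> F" for j
    using that assms(2) itinerary_step gr_funpow_in[of j 1] by auto
  ultimately show "p ` F = {j \<in> {1..m * r}. itinerary m p f j = rotate1 (itinerary m p f i)}"
    by blast
qed

end

text \<open>The sorted multiset gives every itinerary, whose first letters give \<open>f\<close>.
  Then \<open>p\<close> is forced, being the increasing bijection from the positions of a word onto
  those of its rotation.\<close>

lemma inj_on_gr_mset:
  assumes m: "m > 0"
  shows "inj_on (gr_mset m r) (gr_pairs m A r)"
proof (rule inj_onI, clarify)
  fix p f p' f'
  assume a: "(p, f) \<in> gr_pairs m A r" and b: "(p', f') \<in> gr_pairs m A r"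
    and eq: "gr_mset m r (p, f) = gr_mset m r (p', f')"
  note A = gr_facts[OF m a] and B = gr_facts[OF m b]
  have "map (itinerary m p f) [1..<m * r + 1] = map (itinerary m p' f') [1..<m * r + 1]"
    using itinerary_sorted[OF m a] itinerary_sorted[OF m b] eq by simp
  then have it: "itinerary m p f i = itinerary m p' f' i" if "i \<in> {1..m * r}" for i
    using that unfolding map_eq_conv by (auto simp del: upt_Suc)
  have "f i = f' i" for i
  proof (cases "i \<in> {1..m * r}")
    case True
    then show ?thesis using it[OF True] m by (cases m) (auto simp: itinerary_Suc)
  next
    case False
    then show ?thesis using PiE_arb[OF A(3) False] PiE_arb[OF B(3) False] by simp
  qed
  moreover have "p i = p' i" for i
  proof (cases "i \<in> {1..m * r}")
    case True
    define F where "F = {j \<in> {1..m * r}. itinerary m p f j = itinerary m p f i}"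
    have F': "F = {j \<in> {1..m * r}. itinerary m p' f' j = itinerary m p' f' i}"
      using it True by (auto simp: F_def)
    have "p ` F = p' ` F"
      using gr_fibre_image(2)[OF m a True F_def] gr_fibre_image(2)[OF m b True F'] it True
      by auto
    then show ?thesis
      using strict_mono_bij_unique[OF _ gr_fibre_image(1)[OF m a True F_def]
          gr_fibre_image(1)[OF m b True F']] True by (auto simp: F_def)
  next
    case False
    then show ?thesis using A(1) B(1) by (simp add: permutes_not_in)
  qed
  ultimately show "p = p' \<and> f = f'" by auto
qed

lemma ex_strict_mono_bij:
  fixes F F' :: "nat set"
  assumes "finite F" "finite F'" "card F = card F'"
  shows "\<exists>g. strict_mono_on F g \<and> g ` F = F'"
proof -
  obtain h where h: "bij_betw h {..<card F} F" "strict_mono_on {..<card F} h"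
    using ex_bij_betw_strict_mono_card[OF assms(1)] by blast
  obtain h' where h': "bij_betw h' {..<card F} F'" "strict_mono_on {..<card F} h'"
    using ex_bij_betw_strict_mono_card[OF assms(2)] assms(3) by metis
  define g where "g = h' \<circ> inv_into {..<card F} h"
  have inv: "bij_betw (inv_into {..<card F} h) F {..<card F}"
    by (rule bij_betw_inv_into[OF h(1)])
  have "bij_betw g F F'"
    unfolding g_def by (rule bij_betw_trans[OF inv h'(1)])
  moreover have "strict_mono_on F g"
  proof (rule strict_mono_onI)
    fix x y assume xy: "x \<in> F" "y \<in> F" "x < y"
    define a b where "a = inv_into {..<card F} h x" and "b = inv_into {..<card F} h y"
    have ab: "a \<in> {..<card F}" "b \<in> {..<card F}" "h a = x" "h b = y"
      using xy inv h(1) by (auto simp: a_def b_def bij_betw_def f_inv_into_f inv_into_into)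
    have "a < b"
    proof (rule ccontr)
      assume "\<not> a < b"
      then have "h b \<le> h a"
        using strict_mono_onD[OF h(2) ab(2,1)] by (cases "a = b") auto
      then show False using ab xy by simp
    qed
    then show "g x < g y"
      using strict_mono_onD[OF h'(2) ab(1,2)] by (simp add: g_def a_def b_def)
  qed
  ultimately show ?thesis by (auto simp: bij_betw_def)
qed

lemma count_image_mset_inj: "inj f \<Longrightarrow> count (image_mset f M) (f x) = count M x"
  by (induction M) (auto simp: inj_eq)

text \<open>The inverse construction: write the words of \<open>M\<close> in sorted order as
  \<open>W 1, W 2, ...\<close>, let \<open>f\<close> be the first letters and let \<open>p\<close>
  map the positions of each word increasingly onto those of its rotation. Rotation invariance of
  \<open>M\<close> makes these two sets equally large.\<close>

lemma gr_mset_surj: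
  fixes A :: "'a::linorder set"
  assumes m: "m > 0" and M: "M \<in> necklace_msets m A r"
  shows "M \<in> gr_mset m r ` gr_pairs m A r"
proof -
  define I where "I = {1..m * r}"
  define xs where "xs = sorted_list_of_multiset M"
  define W where "W i = xs ! (i - 1)" for i
  have xs: "mset xs = M" "sorted xs" by (simp_all add: xs_def)
  have len: "length xs = m * r" using M xs(1) by (auto simp: necklace_msets_def simp flip: size_mset)
  have finI: "finite I" by (simp add: I_def)
  have W_mono: "W i \<le> W j" if "i \<in> I" "j \<in> I" "i \<le> j" for i j
    unfolding W_def by (rule sorted_nth_mono[OF xs(2)]) (use that len in \<open>auto simp: I_def\<close>)
  have M_eq: "image_mset W (mset_set I) = M"
  proof -
    have "mset_set I = image_mset Suc (mset_set {0..<m * r})"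
      by (simp add: I_def image_mset_mset_set)
        (metis One_nat_def atLeastLessThanSuc_atLeastAtMost image_Suc_lessThan lessThan_atLeast0)
    then have "image_mset W (mset_set I) = image_mset (\<lambda>i. xs ! i) (mset_set {0..<m * r})"
      by (simp add: multiset.map_comp o_def W_def)
    also have "\<dots> = mset (map (\<lambda>i. xs ! i) [0..<m * r])" by simp
    also have "\<dots> = M" using map_nth[of xs] xs(1) len by simp
    finally show ?thesis .
  qed
  have W_prim: "W i \<in> primitive_words m A" if "i \<in> I" for i
  proof -
    have "W i \<in># M" using that finI by (simp flip: M_eq)
    then show ?thesis using M by (auto simp: necklace_msets_def)
  qed
  define F where "F w = {i \<in> I. W i = w}" for w
  have finF: "finite (F w)" for w by (simp add: F_def finI)
  have cardF: "card (F w) = count M w" for w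
  proof -
    have "count (image_mset W (mset_set I)) w = card (W -` {w} \<inter> I)"
      by (simp add: count_image_mset finI)
    also have "W -` {w} \<inter> I = F w" by (auto simp: F_def)
    finally show ?thesis by (simp add: M_eq)
  qed
  have inj_rot: "inj (rotate1 :: 'a list \<Rightarrow> _)" by (rule injI) (simp add: rotate1_eq_iff)
  have "card (F (rotate1 w)) = card (F w)" for w
  proof -
    have "count (image_mset rotate1 M) (rotate1 w) = count M w"
      by (rule count_image_mset_inj[OF inj_rot])
    then show ?thesis using M by (simp add: cardF necklace_msets_def)
  qed
  then have "\<exists>g. strict_mono_on (F w) g \<and> g ` F w = F (rotate1 w)" for w
    using ex_strict_mono_bij[OF finF finF] by metis
  then obtain g where g: "strict_mono_on (F w) (g w)" "g w ` F w = F (rotate1 w)" for w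
    by metis
  define p where "p i = (if i \<in> I then g (W i) i else i)" for i
  define f where "f i = (if i \<in> I then hd (W i) else undefined)" for i
  have p_in: "p i \<in> I" and W_p: "W (p i) = rotate1 (W i)" if "i \<in> I" for i
  proof -
    have "i \<in> F (W i)" using that by (simp add: F_def)
    then have "p i \<in> F (rotate1 (W i))" using g(2) that by (auto simp: p_def)
    then show "p i \<in> I" "W (p i) = rotate1 (W i)" by (auto simp: F_def)
  qed
  have p_less: "p i < p j" if "i \<in> I" "j \<in> I" "i < j" "W i = W j" for i j
    using strict_mono_onD[OF g(1), of i "W i" j] that by (simp add: p_def F_def)
  have "inj_on p I"
  proof (rule inj_onI)
    fix i j assume ij: "i \<in> I" "j \<in> I" "p i = p j"
    then have "rotate1 (W i) = rotate1 (W j)" using W_p by metis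
    then have "W i = W j" by (simp add: rotate1_eq_iff)
    then show "i = j" using p_less ij by (metis less_irrefl linorder_neqE_nat)
  qed
  then have perm: "p permutes I"
    by (intro bij_imp_permutes)
      (use p_in finI endo_inj_surj[of I p] in \<open>auto simp: bij_betw_def\<close>, simp add: p_def)
  have pow: "(p ^^ s) i \<in> I" "W ((p ^^ s) i) = rotate s (W i)" if "i \<in> I" for i s
    using that by (induction s) (simp_all add: p_in W_p)
  have pow_less: "(p ^^ s) i < (p ^^ s) j" if "i \<in> I" "j \<in> I" "i < j" "W i = W j" for i j s
    using that by (induction s) (simp_all add: p_less pow)
  have lenW: "length (W i) = m" if "i \<in> I" for i
    using W_prim[OF that] by (simp add: primitive_words_def)
  have it: "itinerary m p f i = W i" if "i \<in> I" for i
  proof (rule nth_equalityI)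
    fix s assume "s < length (itinerary m p f i)"
    then have s: "s < m" by simp
    have "itinerary m p f i ! s = hd (rotate s (W i))"
      using s by (simp add: itinerary_def f_def pow that)
    also have "\<dots> = W i ! s"
      using s lenW[OF that] by (subst hd_rotate_conv_nth) auto
    finally show "itinerary m p f i ! s = W i ! s" .
  qed (simp add: lenW that)
  have "uniform_cycles m I p"
    unfolding uniform_cycles_def
  proof (intro ballI conjI allI impI)
    fix i assume i: "i \<in> I"
    define w where "w = W i"
    \<comment> \<open>After \<open>m\<close> rotations the word is restored, so
      \<open>p ^^ m\<close> is a strictly increasing self-map of a finite fibre, hence the identity
      there.\<close>
    have sm: "strict_mono_on (F w) (p ^^ m)"
      by (rule strict_mono_onI) (auto simp: F_def intro: pow_less)
    moreover have "(p ^^ m) ` F w \<subseteq> F w"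
      using pow lenW by (fastforce simp: F_def)
    then have "(p ^^ m) ` F w = F w"
      by (rule endo_inj_surj[OF finF _ strict_mono_on_imp_inj_on[OF sm]])
    ultimately show "(p ^^ m) i = i"
      using strict_mono_bij_unique[OF finF sm, of id i] i
      by (simp add: strict_mono_on_def F_def w_def)
  next
    fix i s assume i: "i \<in> I" and s: "0 < s \<and> s < m"
    show "(p ^^ s) i \<noteq> i"
    proof
      assume "(p ^^ s) i = i"
      then have "rotate s (W i) = W i" using pow(2)[OF i, of s] by simp
      then show False using W_prim[OF i] s by (auto simp: primitive_words_def)
    qed
  qed
  moreover have f_in: "f \<in> I \<rightarrow>\<^sub>E A"
  proof (rule PiE_I)
    fix i assume i: "i \<in> I"
    have "W i \<noteq> []" using lenW[OF i] m by auto
    then show "f i \<in> A" using W_prim[OF i] i by (auto simp: f_def primitive_words_def)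
  qed (simp add: f_def)
  moreover have W_Cons: "\<exists>u. W i = f i # u" if "i \<in> I" for i
    using lenW[OF that] m that by (cases "W i") (auto simp: f_def)
  have "mono_on I f"
  proof (rule mono_onI)
    fix i j assume ij: "i \<in> I" "j \<in> I" "i \<le> j"
    obtain u v where "W i = f i # u" "W j = f j # v" using W_Cons ij by metis
    then show "f i \<le> f j" using W_mono[OF ij] by auto
  qed
  moreover have "p i < p j" if ij: "i \<in> I" "j \<in> I" "i < j" "f i = f j" for i j
  proof (cases "W i = W j")
    case True
    then show ?thesis using p_less ij by simp
  next
    case False
    obtain u v where uv: "W i = f i # u" "W j = f j # v" using W_Cons ij by metis
    \<comment> \<open>The common first letter moves to the end of both words. As the tails have
      equal length, neither is a proper prefix of the other, and appending a letter keeps their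
      strict order.\<close>
    have "u < v" using W_mono[of i j] ij uv False by (auto simp: order_less_le)
    moreover have "length u = length v" using lenW[of i] lenW[of j] uv ij by simp
    ultimately have "rotate1 (W i) < rotate1 (W j)"
      using uv ij(4) by (simp add: list_less_def lexord_append_leftI lexord_sufI)
    then have "W (p i) < W (p j)" using W_p ij by simp
    then show ?thesis
      using W_mono[of "p j" "p i"] p_in ij by (meson leD not_le)
  qed
  ultimately have "(p, f) \<in> gr_pairs m A r"
    using perm by (auto simp: gr_pairs_def I_def)
  moreover have "gr_mset m r (p, f) = M"
  proof -
    have "gr_mset m r (p, f) = image_mset W (mset_set I)"
      unfolding gr_mset_def I_def[symmetric] by (auto intro!: image_mset_cong simp: it finI)
    then show ?thesis by (simp add: M_eq)
  qed
  ultimately show ?thesis by force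
qed

lemma bij_betw_gr_mset:
  "m > 0 \<Longrightarrow> bij_betw (gr_mset m r) (gr_pairs m A r) (necklace_msets m A r)"
  unfolding bij_betw_def
  using inj_on_gr_mset gr_mset_in gr_mset_surj by (metis image_subsetI subsetI subset_antisym surj_pair)

section \<open>Multisets of necklaces\<close>

lemma rotate_eq_iff: "rotate s u = rotate s v \<longleftrightarrow> u = v"
  by (induction s) (simp_all add: rotate1_eq_iff)

lemma rotate_primitive:
  assumes "w \<in> primitive_words m A"
  shows "rotate s w \<in> primitive_words m A"
proof -
  have "rotate t (rotate s w) \<noteq> rotate s w" if "0 < t" "t < m" for t
  proof
    assume "rotate t (rotate s w) = rotate s w"
    then have "rotate s (rotate t w) = rotate s w" by (simp add: rotate_rotate add.commute)
    then have "rotate t w = w" by (simp only: rotate_eq_iff)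
    then show False using assms that by (auto simp: primitive_words_def)
  qed
  then show ?thesis using assms by (auto simp: primitive_words_def)
qed

definition rotations :: "'a list \<Rightarrow> 'a list multiset" where
  "rotations w = mset (map (\<lambda>s. rotate s w) [0..<length w])"

lemma size_rotations [simp]: "size (rotations w) = length w"
  by (simp add: rotations_def)

lemma image_rotate1_rotations: "image_mset rotate1 (rotations w) = rotations w"
proof (cases "length w")
  case (Suc k)
  have "map (\<lambda>s. rotate s w) [0..<Suc k] = w # map (\<lambda>s. rotate (Suc s) w) [0..<k]"
    by (simp only: map_upt_Suc) simp
  moreover have "rotate (Suc k) w = w" using rotate_id[of "Suc k" w] Suc by simp
  then have "map (\<lambda>s. rotate (Suc s) w) [0..<Suc k] = map (\<lambda>s. rotate (Suc s) w) [0..<k] @ [w]"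
    by simp
  moreover have "image_mset rotate1 (rotations w) = mset (map (\<lambda>s. rotate (Suc s) w) [0..<Suc k])"
    by (simp add: rotations_def Suc multiset.map_comp o_def)
  ultimately show ?thesis by (simp only: rotations_def Suc) simp
qed (simp add: rotations_def)

text \<open>Primitivity makes the \<open>m\<close> rotations distinct: two equal ones would differ
  by a shorter rotation fixing \<open>w\<close>.\<close>

lemma count_rotations:
  assumes "w \<in> primitive_words m A"
  shows "count (rotations w) v = (if v \<in> (\<lambda>s. rotate s w) ` {..<m} then 1 else 0)"
proof -
  have len: "length w = m" using assms by (simp add: primitive_words_def)
  have "rotate s w \<noteq> rotate t w" if "s < t" "t < m" for s t
  proof
    assume "rotate s w = rotate t w"
    then have "rotate s w = rotate s (rotate (t - s) w)" using that by (simp add: rotate_rotate)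
    then have "rotate (t - s) w = w" by (simp only: rotate_eq_iff)
    then show False using assms that by (auto simp: primitive_words_def)
  qed
  then have "inj_on (\<lambda>s. rotate s w) {0..<m}"
    by (intro linorder_inj_onI) auto
  then have d: "distinct (map (\<lambda>s. rotate s w) [0..<m])"
    by (simp add: distinct_map)
  show ?thesis
    unfolding rotations_def len using d
    by (subst distinct_count_atmost_1[THEN iffD1, rule_format, OF d]) (auto simp: lessThan_atLeast0)
qed

lemma prod_rotations:
  fixes x :: "'a \<Rightarrow> 'b::comm_monoid_mult"
  shows "(\<Prod>v\<in>#rotations w. x (hd v)) = prod_list (map x w)"
proof -
  have "map (\<lambda>s. x (hd (rotate s w))) [0..<length w] = map x w"
  proof (rule nth_equalityI)
    fix s assume "s < length (map (\<lambda>s. x (hd (rotate s w))) [0..<length w])"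
    then have "s < length w" by simp
    moreover from this have "hd (rotate s w) = w ! s" by (subst hd_rotate_conv_nth) auto
    ultimately show "map (\<lambda>s. x (hd (rotate s w))) [0..<length w] ! s = map x w ! s" by simp
  qed simp
  then have "prod_list (map (\<lambda>s. x (hd (rotate s w))) [0..<length w]) = prod_list (map x w)"
    by (rule arg_cong)
  then show ?thesis
    by (simp add: rotations_def multiset.map_comp o_def flip: prod_mset_prod_list)
qed

lemma necklace_count_rotate:
  assumes "M \<in> necklace_msets m A r"
  shows "count M (rotate s w) = count M w"
proof (induction s)
  case (Suc s)
  have "count (image_mset rotate1 M) (rotate1 (rotate s w)) = count M (rotate s w)"
    by (rule count_image_mset_inj) (simp add: inj_def rotate1_eq_iff)
  then show ?case using assms Suc by (simp add: necklace_msets_def)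
qed simp

lemma finite_necklace_msets:
  assumes "finite A"
  shows "finite (necklace_msets m A r)"
proof (rule finite_subset)
  show "necklace_msets m A r \<subseteq> mset ` {xs. set xs \<subseteq> primitive_words m A \<and> length xs = m * r}"
  proof
    fix M assume M: "M \<in> necklace_msets m A r"
    obtain xs where "mset xs = M" using ex_mset by blast
    then show "M \<in> mset ` {xs. set xs \<subseteq> primitive_words m A \<and> length xs = m * r}"
      using M by (auto simp: necklace_msets_def)
  qed
  show "finite (mset ` {xs. set xs \<subseteq> primitive_words m A \<and> length xs = m * r})"
    by (intro finite_imageI finite_lists_length_eq finite_primitive_words assms)
qed

text \<open>Only first letters are weighted: the heads of the \<open>m\<close> rotations of a
  necklace run once through its letters, so each necklace contributes the product of its letters
  exactly once.\<close>

definition necklace_sum :: "nat \<Rightarrow> 'a set \<Rightarrow> ('a \<Rightarrow> real) \<Rightarrow> nat \<Rightarrow> real" where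
  "necklace_sum m A x r = (\<Sum>M\<in>necklace_msets m A r. \<Prod>w\<in>#M. x (hd w))"

lemma repeat_rotations_subset:
  assumes M: "M \<in> necklace_msets m A r" and w: "w \<in> primitive_words m A" and j: "j \<le> count M w"
  shows "repeat_mset j (rotations w) \<subseteq># M"
  using j necklace_count_rotate[OF M, of _ w]
  by (auto simp: subseteq_mset_def count_rotations[OF w])

text \<open>Taking away \<open>j\<close> copies of the necklace of \<open>w\<close> is a bijection
  onto the multisets of \<open>r - j\<close> necklaces, and it divides the weight by the
  \<open>j\<close>-th power of the weight of \<open>w\<close>.\<close>

lemma necklace_sum_remove:
  assumes w: "w \<in> primitive_words m A" and j: "j \<le> r" and m: "m > 0"
  shows "(\<Sum>M\<in>{M \<in> necklace_msets m A r. j \<le> count M w}. \<Prod>w\<in>#M. x (hd w)) =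
    prod_list (map x w) ^ j * necklace_sum m A x (r - j)"
proof -
  let ?R = "repeat_mset j (rotations w)"
  have len: "length w = m" using w by (simp add: primitive_words_def)
  have imR: "image_mset rotate1 (repeat_mset j (rotations w)) = repeat_mset j (rotations w)" for j
    by (induction j) (simp_all add: image_rotate1_rotations)
  have setR: "set_mset ?R \<subseteq> primitive_words m A"
  proof
    fix v assume "v \<in># ?R"
    then have "v \<in># rotations w"
      by (metis count_eq_zero_iff count_repeat_mset mult_0_right)
    then show "v \<in> primitive_words m A"
      using rotate_primitive[OF w] by (auto simp: rotations_def)
  qed
  have prR: "(\<Prod>w\<in>#repeat_mset j (rotations w). x (hd w)) = prod_list (map x w) ^ j" for j
    by (induction j) (simp_all add: prod_rotations)
  have cw: "count (rotations w) w = 1"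
  proof -
    have "w \<in> (\<lambda>s. rotate s w) ` {..<m}"
      using m by (intro image_eqI[of _ _ 0]) auto
    then show ?thesis by (simp add: count_rotations[OF w])
  qed
  have "(\<Sum>M\<in>{M \<in> necklace_msets m A r. j \<le> count M w}. \<Prod>w\<in>#M. x (hd w)) =
      (\<Sum>M\<in>necklace_msets m A (r - j). \<Prod>w\<in>#(M + ?R). x (hd w))"
  proof (rule sum.reindex_bij_witness[of _ "\<lambda>M. M + ?R" "\<lambda>M. M - ?R"])
    fix M assume a: "M \<in> {M \<in> necklace_msets m A r. j \<le> count M w}"
    then have sub: "?R \<subseteq># M" using repeat_rotations_subset[OF _ w] by auto
    then show "M - ?R + ?R = M" by simp
    then show "(\<Prod>w\<in>#(M - ?R + ?R). x (hd w)) = (\<Prod>w\<in>#M. x (hd w))" by simp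
    have "image_mset rotate1 (M - ?R) = image_mset rotate1 M - image_mset rotate1 ?R"
      by (rule image_mset_Diff[OF sub])
    moreover have "size (M - ?R) = m * (r - j)"
      using a size_Diff_submset[OF sub] by (simp add: necklace_msets_def len algebra_simps)
    ultimately show "M - ?R \<in> necklace_msets m A (r - j)"
      using a imR by (auto simp: necklace_msets_def dest: in_diffD)
  next
    fix M assume a: "M \<in> necklace_msets m A (r - j)"
    show "M + ?R - ?R = M" by simp
    have "size (M + ?R) = m * r"
      using a j by (simp add: necklace_msets_def len algebra_simps flip: distrib_left)
    then show "M + ?R \<in> {M \<in> necklace_msets m A r. j \<le> count M w}"
      using a imR setR cw by (auto simp: necklace_msets_def)
  qed
  then show ?thesis
    by (simp add: prR necklace_sum_def sum_distrib_left mult.commute)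
qed

text \<open>Newton's identity between complete and power sums. The size \<open>m * r\<close> of a
  multiset is the sum of its multiplicities, each multiplicity is the number of
  \<open>j \<ge> 1\<close> not exceeding it, and \<open>necklace_sum_remove\<close> evaluates the
  sum for each \<open>j\<close>. The factor \<open>m\<close> appears because power sums run over
  words, not necklaces.\<close>

lemma necklace_sum_rec:
  assumes "finite A" and m: "m > 0"
  shows "real (m * r) * necklace_sum m A x r =
    (\<Sum>j=1..r. (\<Sum>w\<in>primitive_words m A. prod_list (map x w) ^ j) * necklace_sum m A x (r - j))"
proof -
  let ?N = "necklace_msets m A r" and ?P = "primitive_words m A"
  let ?wt = "\<lambda>M. \<Prod>w\<in>#M. x (hd w)"
  have finN: "finite ?N" and finP: "finite ?P"
    using assms by (auto intro: finite_necklace_msets finite_primitive_words)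
  have sz: "real (m * r) = (\<Sum>w\<in>?P. \<Sum>j=1..r. if j \<le> count M w then 1 else 0)" if M: "M \<in> ?N" for M
  proof -
    have "real (count M w) = (\<Sum>j=1..r. if j \<le> count M w then 1 else 0)" if w: "w \<in> ?P" for w
    proof -
      have "count M w * m \<le> m * r"
        using size_mset_mono[OF repeat_rotations_subset[OF M w order_refl]] M w
        by (simp add: necklace_msets_def primitive_words_def)
      then have "count M w \<le> r" using m by (simp add: mult.commute)
      then have "{1..r} \<inter> {j. j \<le> count M w} = {1..count M w}" by auto
      then show ?thesis by (simp add: sum.If_cases)
    qed
    moreover have "size M = (\<Sum>w\<in>?P. count M w)"
      unfolding size_multiset_overloaded_eq
      by (rule sum.mono_neutral_left[OF finP]) (use M in \<open>auto simp: necklace_msets_def not_in_iff\<close>)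
    moreover have "size M = m * r" using M by (simp add: necklace_msets_def)
    ultimately show ?thesis by (metis (no_types, lifting) of_nat_sum sum.cong)
  qed
  have "real (m * r) * necklace_sum m A x r =
      (\<Sum>M\<in>?N. \<Sum>w\<in>?P. \<Sum>j=1..r. if j \<le> count M w then ?wt M else 0)"
    unfolding necklace_sum_def sum_distrib_left
    by (rule sum.cong[OF refl], subst sz, assumption)
      (auto simp: sum_distrib_right intro!: sum.cong)
  also have "\<dots> = (\<Sum>w\<in>?P. \<Sum>j=1..r. \<Sum>M\<in>?N. if j \<le> count M w then ?wt M else 0)"
    by (subst sum.swap) (rule sum.cong[OF refl], subst sum.swap, rule refl)
  also have "\<dots> = (\<Sum>w\<in>?P. \<Sum>j=1..r. prod_list (map x w) ^ j * necklace_sum m A x (r - j))"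
  proof (intro sum.cong refl)
    fix w j assume w: "w \<in> ?P" and j: "j \<in> {1..r}"
    have "(\<Sum>M\<in>?N. if j \<le> count M w then ?wt M else 0) = (\<Sum>M\<in>{M \<in> ?N. j \<le> count M w}. ?wt M)"
      using finN by (simp add: sum.inter_filter)
    then show "(\<Sum>M\<in>?N. if j \<le> count M w then ?wt M else 0) =
        prod_list (map x w) ^ j * necklace_sum m A x (r - j)"
      using necklace_sum_remove[OF w _ m, of j r x] j by simp
  qed
  also have "\<dots> = (\<Sum>j=1..r. (\<Sum>w\<in>?P. prod_list (map x w) ^ j) * necklace_sum m A x (r - j))"
    by (subst sum.swap) (simp add: sum_distrib_right)
  finally show ?thesis .
qed

lemma necklace_sum_0: "m > 0 \<Longrightarrow> necklace_sum m A x 0 = 1"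
proof -
  have "necklace_msets m A 0 = {{#}}" by (auto simp: necklace_msets_def)
  then show ?thesis by (simp add: necklace_sum_def)
qed

lemma sum_gr_pairs:
  assumes m: "m > 0"
  shows "(\<Sum>(p, f)\<in>gr_pairs m A r. \<Prod>i=1..m * r. x (f i)) = necklace_sum m A x r"
proof -
  have "(\<Sum>(p, f)\<in>gr_pairs m A r. \<Prod>i=1..m * r. x (f i)) =
      (\<Sum>pf\<in>gr_pairs m A r. \<Prod>w\<in>#gr_mset m r pf. x (hd w))"
  proof (rule sum.cong[OF refl], clarify)
    fix p and f :: "nat \<Rightarrow> 'a"
    have "hd (itinerary m p f i) = f i" for i
      using m by (cases m) (simp_all add: itinerary_Suc)
    then show "(\<Prod>i=1..m * r. x (f i)) = (\<Prod>w\<in>#gr_mset m r (p, f). x (hd w))"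
      by (simp add: gr_mset_def multiset.map_comp o_def prod_unfold_prod_mset)
  qed
  also have "\<dots> = necklace_sum m A x r"
    unfolding necklace_sum_def by (rule sum.reindex_bij_betw[OF bij_betw_gr_mset[OF m]])
  finally show ?thesis .
qed

section \<open>Counting words by parity of their level sets\<close>

definition chain_step :: "nat set \<Rightarrow> nat set \<Rightarrow> nat \<Rightarrow> nat \<Rightarrow> nat \<Rightarrow> bool" where
  "chain_step E W i u v \<longleftrightarrow> (if i \<in> E then u = v else if i \<in> W then u \<le> v else u < v)"

text \<open>Letters have no upper bound but the last one is prescribed, so that counting can proceed
  by removing the last position. \<open>S\<close> will be the set of all positive letters or just
  \<open>{1}\<close>.\<close>

definition stepped_words :: "nat set \<Rightarrow> nat set \<Rightarrow> nat set \<Rightarrow> nat \<Rightarrow> nat \<Rightarrow> (nat \<Rightarrow> nat) set" where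
  "stepped_words S E W n v = {f \<in> {1..n} \<rightarrow>\<^sub>E {1..}. f 1 \<in> S \<and> f n = v \<and>
     (\<forall>i\<in>{1..<n}. chain_step E W i (f i) (f (Suc i)))}"

lemma stepped_words_1: "v \<ge> 1 \<Longrightarrow> stepped_words S E W 1 v = (if v \<in> S then {(\<lambda>_. undefined)(1 := v)} else {})"
  by (auto simp: stepped_words_def PiE_def extensional_def fun_eq_iff)

lemma bij_betw_stepped_words_Suc:
  assumes "n \<ge> 1" "v \<ge> 1"
  shows "bij_betw (\<lambda>(u, f). f(Suc n := v))
    (SIGMA u:{u \<in> {1..v}. chain_step E W n u v}. stepped_words S E W n u) (stepped_words S E W (Suc n) v)"
proof (rule bij_betw_byWitness[where f' = "\<lambda>f. (f n, f(Suc n := undefined))"])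
  have ext: "f (Suc n) = undefined" if "f \<in> stepped_words S E W n u" for f u
    using that by (auto simp: stepped_words_def PiE_def extensional_def)
  have inv: "((f(Suc n := v)) n, (f(Suc n := v))(Suc n := undefined)) = (u, f)"
    if "f \<in> stepped_words S E W n u" for f u
    using that ext[OF that] by (simp add: stepped_words_def fun_upd_idem)
  show "\<forall>x\<in>SIGMA u:{u \<in> {1..v}. chain_step E W n u v}. stepped_words S E W n u.
      (\<lambda>f. (f n, f(Suc n := undefined))) (case x of (u, f) \<Rightarrow> f(Suc n := v)) = x"
    using inv by (simp add: Sigma_def del: fun_upd_apply fun_upd_upd)
  show "\<forall>f\<in>stepped_words S E W (Suc n) v. (case (f n, f(Suc n := undefined)) of (u, f) \<Rightarrow> f(Suc n := v)) = f"
    by (auto simp: stepped_words_def)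
  show "(\<lambda>(u, f). f(Suc n := v)) ` (SIGMA u:{u \<in> {1..v}. chain_step E W n u v}. stepped_words S E W n u)
      \<subseteq> stepped_words S E W (Suc n) v"
  proof clarify
    fix u f assume u: "u \<in> {1..v}" "chain_step E W n u v" and f: "f \<in> stepped_words S E W n u"
    have "f(Suc n := v) \<in> {1..Suc n} \<rightarrow>\<^sub>E {1..}"
      using f assms(2) by (auto simp: stepped_words_def PiE_def Pi_def extensional_def)
    then show "f(Suc n := v) \<in> stepped_words S E W (Suc n) v"
      using u f assms(1) by (auto simp: stepped_words_def less_Suc_eq)
  qed
  show "(\<lambda>f. (f n, f(Suc n := undefined))) ` stepped_words S E W (Suc n) v
      \<subseteq> (SIGMA u:{u \<in> {1..v}. chain_step E W n u v}. stepped_words S E W n u)"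
  proof clarify
    fix f assume f: "f \<in> stepped_words S E W (Suc n) v"
    have st: "chain_step E W n (f n) v" using f assms(1) by (auto simp: stepped_words_def)
    then have "f n \<le> v" by (auto simp: chain_step_def split: if_splits)
    moreover have "f n \<ge> 1" using f assms(1) by (auto simp: stepped_words_def PiE_def Pi_def)
    moreover have "f(Suc n := undefined) \<in> {1..n} \<rightarrow>\<^sub>E {1..}"
      using f by (auto simp: stepped_words_def PiE_def Pi_def extensional_def)
    then have "f(Suc n := undefined) \<in> stepped_words S E W n (f n)"
      using f assms(1) by (auto simp: stepped_words_def)
    ultimately show "f n \<in> {u \<in> {1..v}. chain_step E W n u v} \<and>
        f(Suc n := undefined) \<in> stepped_words S E W n (f n)"
      using st by auto
  qed
qed

lemma finite_stepped_words: "n \<ge> 1 \<Longrightarrow> v \<ge> 1 \<Longrightarrow> finite (stepped_words S E W n v)"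
proof (induction n arbitrary: v rule: nat_induct_at_least)
  case base
  then show ?case by (simp add: stepped_words_1 del: One_nat_def)
next
  case (Suc n)
  have "finite (SIGMA u:{u \<in> {1..v}. chain_step E W n u v}. stepped_words S E W n u)"
    using Suc by (intro finite_SigmaI) auto
  then show ?case
    using bij_betw_finite[OF bij_betw_stepped_words_Suc[OF Suc.hyps(1) Suc.prems]] by blast
qed

lemma card_stepped_words_Suc:
  assumes "n \<ge> 1" "v \<ge> 1"
  shows "card (stepped_words S E W (Suc n) v) =
    (if n \<in> E then card (stepped_words S E W n v)
     else if n \<in> W then \<Sum>u=1..v. card (stepped_words S E W n u) else \<Sum>u=1..v-1. card (stepped_words S E W n u))"
proof -
  have "card (stepped_words S E W (Suc n) v) =
      (\<Sum>u\<in>{u \<in> {1..v}. chain_step E W n u v}. card (stepped_words S E W n u))"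
    unfolding bij_betw_same_card[OF bij_betw_stepped_words_Suc[OF assms], symmetric]
    by (rule card_SigmaI) (auto intro!: finite_stepped_words assms(1))
  also have "{u \<in> {1..v}. chain_step E W n u v} =
      (if n \<in> E then {v} else if n \<in> W then {1..v} else {1..v - 1})"
    using assms(2) by (auto simp: chain_step_def)
  finally show ?thesis by auto
qed

lemma sum_choose_shift:
  assumes "a \<le> q"
  shows "(\<Sum>u=1..v. (u + a - 1) choose q) = (v + a) choose Suc q"
proof (induction v)
  case 0
  then show ?case using assms by simp
next
  case (Suc v)
  then show ?case by simp
qed

text \<open>Each position outside \<open>E\<close> is a summation over the previous letter and
  raises the lower index by one. A weak step raises the upper index as well; a strict step stops one
  letter earlier, which cancels that shift. The start contributes \<open>\<delta> = 1\<close> if the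
  first letter is free and \<open>\<delta> = 0\<close> if it is 1.\<close>

lemma sum_card_stepped_words:
  assumes base: "\<And>v. v \<ge> 1 \<Longrightarrow> card ({1..v} \<inter> S) = (v + \<delta> - 1) choose \<delta>"
    and "n \<ge> 1" "v \<ge> 1"
  shows "(\<Sum>u=1..v. card (stepped_words S E W n u)) =
    (v + \<delta> - 1 + card {i \<in> {1..<n}. i \<notin> E \<and> i \<in> W}) choose (card {i \<in> {1..<n}. i \<notin> E} + \<delta>)"
  using assms(2,3)
proof (induction n arbitrary: v rule: nat_induct_at_least)
  case base
  have "(\<Sum>u=1..v. card (stepped_words S E W 1 u)) = (\<Sum>u=1..v. if u \<in> S then 1 else 0)"
    by (intro sum.cong) (auto simp: stepped_words_1 simp del: One_nat_def)
  also have "\<dots> = card ({1..v} \<inter> S)" by (simp add: sum.If_cases Int_def)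
  finally show ?case using assms(1)[OF base] by simp
next
  case (Suc n)
  define a q where "a = card {i \<in> {1..<n}. i \<notin> E \<and> i \<in> W}" and "q = card {i \<in> {1..<n}. i \<notin> E}"
  have aq: "a \<le> q" unfolding a_def q_def by (intro card_mono) auto
  have IH: "(\<Sum>u=1..v. card (stepped_words S E W n u)) = (v + \<delta> + a - 1) choose (q + \<delta>)" if "v \<ge> 1" for v
    using Suc.IH[OF that] that by (simp add: a_def q_def)
  \<comment> \<open>At \<open>v = 1\<close> the sum is empty, but truncated subtraction would turn
    the binomial into \<open>0 choose 0\<close> when \<open>\<delta>\<close>, \<open>a\<close> and
    \<open>q\<close> are all 0.\<close>
  have IH0: "(\<Sum>u=1..v-1. card (stepped_words S E W n u)) = (if v \<le> 1 then 0 else (v - 1 + \<delta> + a - 1) choose (q + \<delta>))" for v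
    using IH[of "v - 1"] by auto
  have a': "card {i \<in> {1..<Suc n}. i \<notin> E \<and> i \<in> W} = (if n \<notin> E \<and> n \<in> W then Suc a else a)"
  proof -
    have "{i \<in> {1..<Suc n}. i \<notin> E \<and> i \<in> W} =
        (if n \<notin> E \<and> n \<in> W then insert n {i \<in> {1..<n}. i \<notin> E \<and> i \<in> W} else {i \<in> {1..<n}. i \<notin> E \<and> i \<in> W})"
      using Suc.hyps(1) by (auto simp: less_Suc_eq)
    then show ?thesis by (simp add: a_def)
  qed
  have q': "card {i \<in> {1..<Suc n}. i \<notin> E} = (if n \<notin> E then Suc q else q)"
  proof -
    have "{i \<in> {1..<Suc n}. i \<notin> E} =
        (if n \<notin> E then insert n {i \<in> {1..<n}. i \<notin> E} else {i \<in> {1..<n}. i \<notin> E})"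
      using Suc.hyps(1) by (auto simp: less_Suc_eq)
    then show ?thesis by (simp add: q_def)
  qed
  consider "n \<in> E" | "n \<notin> E" "n \<in> W" | "n \<notin> E" "n \<notin> W" by blast
  then show ?case
  proof cases
    case 1
    have "(\<Sum>u=1..v. card (stepped_words S E W (Suc n) u)) = (\<Sum>u=1..v. card (stepped_words S E W n u))"
      using Suc.hyps(1) 1 by (intro sum.cong) (auto simp: card_stepped_words_Suc)
    then show ?thesis using IH[OF Suc.prems] Suc.prems 1 unfolding a' q' by simp
  next
    case 2
    have "(\<Sum>u=1..v. card (stepped_words S E W (Suc n) u)) = (\<Sum>u=1..v. (u + (\<delta> + a) - 1) choose (q + \<delta>))"
      using Suc.hyps(1) 2 IH by (intro sum.cong) (auto simp: card_stepped_words_Suc add.assoc)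
    also have "\<dots> = (v + (\<delta> + a)) choose Suc (q + \<delta>)"
      by (rule sum_choose_shift) (use aq in simp)
    finally show ?thesis using Suc.prems 2 unfolding a' q' by (simp add: add.assoc)
  next
    case 3
    have "(\<Sum>u=1..v. card (stepped_words S E W (Suc n) u)) =
        (\<Sum>u=1..v. if u \<le> 1 then 0 else (u - 1 + (\<delta> + a) - 1) choose (q + \<delta>))"
      using Suc.hyps(1) 3 IH0 by (intro sum.cong) (auto simp: card_stepped_words_Suc add.assoc)
    also have "\<dots> = (\<Sum>u\<in>{2..v}. (u - 1 + (\<delta> + a) - 1) choose (q + \<delta>))"
      by (rule sum.mono_neutral_cong_right) auto
    also have "\<dots> = (\<Sum>u=1..v-1. (u + (\<delta> + a) - 1) choose (q + \<delta>))"
      by (rule sum.reindex_bij_witness[of _ "\<lambda>u. u + 1" "\<lambda>u. u - 1"]) auto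
    also have "\<dots> = (v - 1 + (\<delta> + a)) choose Suc (q + \<delta>)"
      by (rule sum_choose_shift) (use aq in simp)
    finally show ?thesis using Suc.prems 3 unfolding a' q' by (simp add: add.assoc)
  qed
qed

text \<open>If a weakly increasing \<open>f\<close> ties at \<open>i\<close> and \<open>j\<close>,
  it ties at all positions in between, so conditions on neighbours suffice.\<close>

lemma mono_on_interval_iff:
  fixes f :: "nat \<Rightarrow> 'a::linorder" and p :: "nat \<Rightarrow> nat"
  shows "(mono_on {1..n} f \<and> (\<forall>i\<in>{1..n}. \<forall>j\<in>{1..n}. i < j \<and> f i = f j \<longrightarrow> p i < p j)) \<longleftrightarrow>
    (\<forall>i\<in>{1..<n}. f i \<le> f (Suc i) \<and> (f i = f (Suc i) \<longrightarrow> p i < p (Suc i)))" (is "?L \<longleftrightarrow> ?R")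
proof
  assume ?L
  then show ?R by (auto simp: mono_on_def)
next
  assume R: ?R
  have le: "f i \<le> f j" if "1 \<le> i" "i \<le> j" "j \<le> n" for i j
    using that(2,3)
  proof (induction j rule: dec_induct)
    case (step k)
    then have "f i \<le> f k" by simp
    also have "f k \<le> f (Suc k)" using R step that(1) by auto
    finally show ?case .
  qed simp
  have less: "p i < p j" if "1 \<le> i" "Suc i \<le> j" "j \<le> n" "f i = f j" for i j
    using that(2,3,4)
  proof (induction j rule: dec_induct)
    case base
    then show ?case using R that(1) by auto
  next
    case (step k)
    have "f i \<le> f k" "f k \<le> f (Suc k)"
      by (rule le; use that(1) step.hyps step.prems in simp)+
    then have eq: "f i = f k" "f k = f (Suc k)" using step.prems by auto
    then have "p i < p k" using step by simp
    also have "p k < p (Suc k)" using R eq step that(1) by auto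
    finally show ?case .
  qed
  show ?L using le less by (auto simp: mono_on_def)
qed

section \<open>Parities of level sets and positions of strict increase\<close>

context
  fixes n l :: nat and f :: "nat \<Rightarrow> nat"
  assumes f_in: "\<And>i. i \<in> {1..n} \<Longrightarrow> f i \<in> {1..l}" and f_mono: "mono_on {1..n} f"
begin

abbreviation (input) "fib a \<equiv> card {i \<in> {1..n}. f i = a}"
abbreviation (input) "cum v \<equiv> card {i \<in> {1..n}. f i \<le> v}"

lemma cum_Suc: "cum (Suc a) = cum a + fib (Suc a)"
proof -
  have "{i \<in> {1..n}. f i \<le> Suc a} = {i \<in> {1..n}. f i \<le> a} \<union> {i \<in> {1..n}. f i = Suc a}" by auto
  then show ?thesis by (simp add: card_Un_disjoint disjoint_iff)
qed

lemma cum_0: "cum 0 = 0"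
proof -
  have "{i \<in> {1..n}. f i \<le> 0} = {}" using f_in by fastforce
  then show ?thesis by simp
qed

text \<open>Together with \<open>ascent_cum\<close>: the strict increases of \<open>f\<close> occur
  exactly at the values of \<open>cum\<close> strictly between 0 and \<open>n\<close>. Parity
  conditions on level sets thereby become parity conditions on positions.\<close>

lemma cum_ascent:
  assumes "i \<in> {1..<n}" "f i < f (Suc i)"
  shows "cum (f i) = i"
proof -
  have "{j \<in> {1..n}. f j \<le> f i} = {1..i}"
  proof (intro equalityI subsetI)
    fix j assume j: "j \<in> {j \<in> {1..n}. f j \<le> f i}"
    have "\<not> Suc i \<le> j"
    proof
      assume "Suc i \<le> j"
      then have "f (Suc i) \<le> f j" using f_mono j assms(1) by (auto simp: mono_on_def)
      then show False using j assms(2) by auto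
    qed
    then show "j \<in> {1..i}" using j by auto
  qed (use f_mono assms(1) in \<open>auto simp: mono_on_def\<close>)
  then show ?thesis by simp
qed

lemma ascent_cum:
  assumes "cum v \<in> {1..<n}"
  shows "f (cum v) < f (Suc (cum v))"
proof -
  let ?X = "{i \<in> {1..n}. f i \<le> v}"
  define k where "k = Max ?X"
  have ne: "?X \<noteq> {}" using assms by (metis atLeastLessThan_iff card.empty not_one_le_zero)
  have k: "k \<in> ?X" unfolding k_def by (rule Max_in) (use ne in auto)
  have "?X = {1..k}"
  proof (intro equalityI subsetI)
    fix j assume "j \<in> ?X"
    then show "j \<in> {1..k}" using Max_ge[of ?X j] by (simp add: k_def)
  next
    fix j assume j: "j \<in> {1..k}"
    then have "f j \<le> f k" using f_mono k by (auto simp: mono_on_def)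
    then show "j \<in> ?X" using j k by auto
  qed
  then have ck: "cum v = k" by simp
  have "Suc k \<notin> ?X" using \<open>?X = {1..k}\<close> by auto
  then have "v < f (Suc k)" using assms ck by auto
  then show ?thesis using k ck by simp
qed

text \<open>All level sets are even iff all cumulative counts are, which means that \<open>f\<close>
  can increase only at even positions.\<close>

lemma fibres_even_iff:
  assumes "even n"
  shows "(\<forall>a\<in>{1..l}. even (fib a)) \<longleftrightarrow> (\<forall>i\<in>{1..<n}. odd i \<longrightarrow> f i = f (Suc i))"
proof
  assume h: "\<forall>a\<in>{1..l}. even (fib a)"
  have ev: "even (cum v)" if "v \<le> l" for v
    using that
  proof (induction v)
    case (Suc v)
    then show ?case using h unfolding cum_Suc by auto
  qed (simp only: cum_0 even_zero)
  show "\<forall>i\<in>{1..<n}. odd i \<longrightarrow> f i = f (Suc i)"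
  proof (intro ballI impI)
    fix i assume i: "i \<in> {1..<n}" "odd i"
    have "f i \<le> f (Suc i)" using f_mono i by (auto simp: mono_on_def)
    moreover have "\<not> f i < f (Suc i)"
      using cum_ascent[OF i(1)] ev[of "f i"] f_in[of i] i by auto
    ultimately show "f i = f (Suc i)" by simp
  qed
next
  assume h: "\<forall>i\<in>{1..<n}. odd i \<longrightarrow> f i = f (Suc i)"
  have ev: "even (cum v)" for v
  proof (rule ccontr)
    assume o: "odd (cum v)"
    have "cum v \<le> card {1..n}" by (rule card_mono) auto
    then have "cum v \<in> {1..<n}" using o assms by (cases "cum v = n") (auto intro!: Suc_leI Nat.gr0I)
    then show False using ascent_cum[of v] h o by fastforce
  qed
  show "\<forall>a\<in>{1..l}. even (fib a)"
  proof
    fix a assume "a \<in> {1..l}"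
    then obtain b where "a = Suc b" by (cases a) auto
    then show "even (fib a)" using ev[of a] ev[of b] cum_Suc[of b] by simp
  qed
qed

text \<open>With odd level sets exactly at 1 and \<open>l\<close>, the cumulative counts are odd
  from letter 1 to letter \<open>l - 1\<close>, so \<open>f\<close> can increase only at odd
  positions. Odd level sets are nonempty, which forces the two end values.\<close>

lemma fibres_odd_ends_iff:
  assumes n: "even n" "n > 0" and l: "l \<ge> 2"
  shows "(\<forall>a\<in>{1..l}. even (fib a + (if a \<in> {1, l} then 1 else 0))) \<longleftrightarrow>
    f 1 = 1 \<and> f n = l \<and> (\<forall>i\<in>{1..<n}. even i \<longrightarrow> f i = f (Suc i))"
proof
  assume h: "\<forall>a\<in>{1..l}. even (fib a + (if a \<in> {1, l} then 1 else 0))"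
  have ne: "\<exists>i\<in>{1..n}. f i = a" if "a \<in> {1, l}" for a
  proof -
    have "odd (fib a)" using h that l by auto
    then have "{i \<in> {1..n}. f i = a} \<noteq> {}" by (metis card.empty even_zero)
    then show ?thesis by blast
  qed
  obtain i where "i \<in> {1..n}" "f i = 1" using ne[of 1] by auto
  then have f1: "f 1 = 1" using mono_onD[OF f_mono, of 1 i] f_in[of 1] n by auto
  obtain i where "i \<in> {1..n}" "f i = l" using ne[of l] by auto
  then have fn: "f n = l" using mono_onD[OF f_mono, of i n] f_in[of n] n by auto
  have od: "odd (cum v)" if "1 \<le> v" "v < l" for v
    using that
  proof (induction v rule: nat_induct_at_least)
    case base
    have "cum (Suc 0) = fib (Suc 0)" unfolding cum_Suc cum_0 by simp
    moreover have "odd (fib (Suc 0))" using bspec[OF h, of "Suc 0"] l by simp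
    ultimately show ?case by simp
  next
    case (Suc v)
    then show ?case using h unfolding cum_Suc by auto
  qed
  have "f i = f (Suc i)" if i: "i \<in> {1..<n}" "even i" for i
  proof -
    have "f i \<le> f (Suc i)" using f_mono i by (auto simp: mono_on_def)
    moreover have "\<not> f i < f (Suc i)"
      using cum_ascent[OF i(1)] od[of "f i"] f_in[of i] f_in[of "Suc i"] i by auto
    ultimately show "f i = f (Suc i)" by simp
  qed
  then show "f 1 = 1 \<and> f n = l \<and> (\<forall>i\<in>{1..<n}. even i \<longrightarrow> f i = f (Suc i))"
    using f1 fn by blast
next
  assume h: "f 1 = 1 \<and> f n = l \<and> (\<forall>i\<in>{1..<n}. even i \<longrightarrow> f i = f (Suc i))"
  have od: "odd (cum v)" if v: "1 \<le> v" "v < l" for v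
  proof
    assume e: "even (cum v)"
    have "1 \<in> {i \<in> {1..n}. f i \<le> v}" using h v n by auto
    then have "cum v > 0" by (intro card_gt_0_iff[THEN iffD2] conjI) auto
    moreover have "n \<in> {1..n} - {i \<in> {1..n}. f i \<le> v}" using h v n by simp
    then have "{i \<in> {1..n}. f i \<le> v} \<subset> {1..n}" by blast
    then have "cum v < card {1..n}" by (intro psubset_card_mono) auto
    ultimately have "cum v \<in> {1..<n}" by simp
    then show False using ascent_cum[of v] h e by fastforce
  qed
  have par_odd: "x = y + z \<Longrightarrow> odd y \<Longrightarrow> even x \<Longrightarrow> odd z"
    and par_even: "x = y + z \<Longrightarrow> odd y \<Longrightarrow> odd x \<Longrightarrow> even z" for x y z :: nat
    by simp_all
  have cl: "cum l = n"
  proof -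
    have "{i \<in> {1..n}. f i \<le> l} = {1..n}" using f_in by auto
    then show ?thesis by simp
  qed
  show "\<forall>a\<in>{1..l}. even (fib a + (if a \<in> {1, l} then 1 else 0))"
  proof
    fix a assume a: "a \<in> {1..l}"
    then obtain b where b: "a = Suc b" by (cases a) auto
    have c: "cum a = cum b + fib a" using cum_Suc[of b] b by simp
    consider "a = 1" | "a = l" "a \<noteq> 1" | "1 < a" "a < l" using a by fastforce
    then show "even (fib a + (if a \<in> {1, l} then 1 else 0))"
    proof cases
      case 1
      then have b0: "b = 0" using b by simp
      have "cum a = fib a" using c unfolding b0 cum_0 add_0 .
      moreover have "odd (cum a)" using 1 l by (intro od) auto
      ultimately have "odd (fib a)" by metis
      then show ?thesis using 1 by simp
    next
      case 2
      have "odd (cum b)" using 2 a b by (intro od) auto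
      moreover have "even (cum a)" using cl n(1) 2(1) by metis
      ultimately have "odd (fib a)" by (rule par_odd[OF c])
      then show ?thesis using 2 by simp
    next
      case 3
      have "odd (cum b)" using 3 b by (intro od) auto
      moreover have "odd (cum a)" using 3 by (intro od) auto
      ultimately have "even (fib a)" by (rule par_even[OF c])
      then show ?thesis using 3 by simp
    qed
  qed
qed

end

section \<open>Polynomial dependence on the number of letters\<close>

text \<open>The \<open>j\<close>-th power sum of the weights of primitive words over
  \<open>L\<close> signed letters; the variable stands for the square of the letter sum. The power
  sum of the signs with exponent \<open>j * d\<close> is \<open>L\<close> if the exponent is even
  and the letter sum if it is odd. In the latter case \<open>d\<close> is odd, so
  \<open>m div d\<close> is even for even \<open>m\<close> and may be halved.\<close>

definition cycle_poly :: "nat \<Rightarrow> real \<Rightarrow> nat \<Rightarrow> real poly" where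
  "cycle_poly m L j = (\<Sum>d | d dvd m. smult (of_int (moebius d))
     (if even (j * d) then [:L ^ (m div d):] else monom 1 (m div d div 2)))"

text \<open>The recursion \<open>necklace_sum_rec\<close> solved for its top term. The number of
  letters is a real argument so that -1 can be inserted later.\<close>

fun necklace_poly :: "nat \<Rightarrow> real \<Rightarrow> nat \<Rightarrow> real poly" where
  "necklace_poly m L 0 = 1"
| "necklace_poly m L (Suc r) = smult (1 / (real m * real (Suc r)))
     (\<Sum>j\<le>r. cycle_poly m L (Suc j) * necklace_poly m L (r - j))"

lemma poly_cycle_poly:
  fixes x :: "'a \<Rightarrow> real"
  assumes A: "finite A" and x: "\<And>a. a \<in> A \<Longrightarrow> x a \<in> {1, -1}" and m: "even m" "m > 0"
  shows "poly (cycle_poly m (real (card A)) j) ((\<Sum>a\<in>A. x a)\<^sup>2) =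
    (\<Sum>w\<in>primitive_words m A. prod_list (map x w) ^ j)"
  unfolding sum_primitive_words[OF A m(2)] cycle_poly_def poly_sum poly_smult
proof (rule sum.cong[OF refl])
  fix d assume "d \<in> {d. d dvd m}"
  then have d: "d dvd m" by simp
  show "of_int (moebius d) * poly (if even (j * d) then [:real (card A) ^ (m div d):]
      else monom 1 (m div d div 2)) ((\<Sum>a\<in>A. x a)\<^sup>2) =
    of_int (moebius d) * (\<Sum>a\<in>A. x a ^ (j * d)) ^ (m div d)"
  proof (cases "even (j * d)")
    case True
    have "x a ^ (j * d) = 1" if "a \<in> A" for a
      using x[OF that] True by (auto simp: minus_one_power_iff)
    then show ?thesis using True by simp
  next
    case False
    have "x a ^ (j * d) = x a" if "a \<in> A" for a
      using x[OF that] False by (auto simp: minus_one_power_iff)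
    then have "(\<Sum>a\<in>A. x a ^ (j * d)) = (\<Sum>a\<in>A. x a)" by simp
    moreover have "even (m div d)"
      using d m(1) False by (metis dvd_mult_div_cancel even_mult_iff)
    then have "((\<Sum>a\<in>A. x a)\<^sup>2) ^ (m div d div 2) = (\<Sum>a\<in>A. x a) ^ (m div d)"
      by (simp flip: power_mult)
    ultimately show ?thesis using False by (simp add: poly_monom)
  qed
qed

lemma poly_necklace_poly:
  fixes x :: "'a \<Rightarrow> real"
  assumes A: "finite A" and x: "\<And>a. a \<in> A \<Longrightarrow> x a \<in> {1, -1}" and m: "even m" "m > 0"
  shows "poly (necklace_poly m (real (card A)) r) ((\<Sum>a\<in>A. x a)\<^sup>2) = necklace_sum m A x r"
proof (induction r rule: less_induct)
  case (less r)
  show ?case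
  proof (cases r)
    case 0
    then show ?thesis using m by (simp add: necklace_sum_0)
  next
    case (Suc q)
    have "poly (necklace_poly m (real (card A)) r) ((\<Sum>a\<in>A. x a)\<^sup>2) =
        1 / (real m * real r) * (\<Sum>j\<le>q. (\<Sum>w\<in>primitive_words m A. prod_list (map x w) ^ Suc j) *
          necklace_sum m A x (q - j))"
      using less Suc by (simp add: poly_sum poly_cycle_poly[OF A x m])
    also have "(\<Sum>j\<le>q. (\<Sum>w\<in>primitive_words m A. prod_list (map x w) ^ Suc j) *
          necklace_sum m A x (q - j)) =
        (\<Sum>j=1..r. (\<Sum>w\<in>primitive_words m A. prod_list (map x w) ^ j) * necklace_sum m A x (r - j))"
      by (rule sum.reindex_bij_witness[of _ "\<lambda>j. j - 1" Suc]) (auto simp: Suc)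
    also have "\<dots> = real (m * r) * necklace_sum m A x r"
      by (rule necklace_sum_rec[OF A m(2), symmetric])
    finally have "poly (necklace_poly m (real (card A)) r) ((\<Sum>a\<in>A. x a)\<^sup>2) =
        1 / (real m * real r) * (real (m * r) * necklace_sum m A x r)" .
    moreover have "real m * real r \<noteq> 0" using m Suc by simp
    ultimately show ?thesis by simp
  qed
qed

section \<open>Polynomial functions of the number of letters\<close>

definition polyfun :: "(real \<Rightarrow> real) \<Rightarrow> bool" where
  "polyfun f \<longleftrightarrow> (\<exists>p. \<forall>x. f x = poly p x)"

lemma polyfun_const: "polyfun (\<lambda>_. c)"
  unfolding polyfun_def by (rule exI[of _ "[:c:]"]) simp

lemma polyfun_id: "polyfun (\<lambda>x. x)"
  unfolding polyfun_def by (rule exI[of _ "[:0, 1:]"]) simp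

lemma polyfun_add:
  assumes "polyfun f" "polyfun g"
  shows "polyfun (\<lambda>x. f x + g x)"
proof -
  obtain p q where "\<forall>x. f x = poly p x" "\<forall>x. g x = poly q x"
    using assms by (auto simp: polyfun_def)
  then show ?thesis
    unfolding polyfun_def by (intro exI[of _ "p + q"]) simp
qed

lemma polyfun_diff:
  assumes "polyfun f" "polyfun g"
  shows "polyfun (\<lambda>x. f x - g x)"
proof -
  obtain p q where "\<forall>x. f x = poly p x" "\<forall>x. g x = poly q x"
    using assms by (auto simp: polyfun_def)
  then show ?thesis
    unfolding polyfun_def by (intro exI[of _ "p - q"]) simp
qed

lemma polyfun_mult:
  assumes "polyfun f" "polyfun g"
  shows "polyfun (\<lambda>x. f x * g x)"
proof -
  obtain p q where "\<forall>x. f x = poly p x" "\<forall>x. g x = poly q x"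
    using assms by (auto simp: polyfun_def)
  then show ?thesis
    unfolding polyfun_def by (intro exI[of _ "p * q"]) simp
qed

lemma polyfun_power: "polyfun f \<Longrightarrow> polyfun (\<lambda>x. f x ^ n)"
  unfolding polyfun_def by (metis poly_power)

lemma polyfun_sum: "(\<And>i. i \<in> I \<Longrightarrow> polyfun (f i)) \<Longrightarrow> polyfun (\<lambda>x. \<Sum>i\<in>I. f i x)"
  by (induction I rule: infinite_finite_induct) (auto intro: polyfun_const polyfun_add)

lemma polyfun_prod: "(\<And>i. i \<in> I \<Longrightarrow> polyfun (f i)) \<Longrightarrow> polyfun (\<lambda>x. \<Prod>i\<in>I. f i x)"
  by (induction I rule: infinite_finite_induct) (auto intro: polyfun_const polyfun_mult)

lemma polyfun_gbinomial: "polyfun f \<Longrightarrow> polyfun (\<lambda>x. f x gchoose k)"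
  unfolding gbinomial_prod_rev divide_inverse
  by (intro polyfun_mult polyfun_prod polyfun_diff polyfun_const)

lemmas polyfun_intros = polyfun_const polyfun_id polyfun_add polyfun_diff polyfun_mult
  polyfun_power polyfun_sum polyfun_gbinomial

text \<open>Two polynomials that agree at infinitely many points coincide. The range starts at 2
  because the alternating case needs distinct letters 1 and \<open>l\<close>.\<close>

lemma polyfun_eqI:
  assumes "polyfun f" "polyfun g" "\<And>l::nat. l \<ge> 2 \<Longrightarrow> f (real l) = g (real l)"
  shows "f x = g x"
proof -
  obtain p q where p: "\<And>x. f x = poly p x" and q: "\<And>x. g x = poly q x"
    using assms(1,2) by (auto simp: polyfun_def)
  have "p - q = 0"
  proof (rule ccontr)
    assume "p - q \<noteq> 0"
    then have "finite {x. poly (p - q) x = 0}" by (rule poly_roots_finite)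
    moreover have "real ` {2..} \<subseteq> {x. poly (p - q) x = 0}"
      using assms(3) p q by auto
    ultimately have "finite (real ` {2..})" by (rule finite_subset[rotated])
    then have "finite {2::nat..}" by (simp add: finite_image_iff)
    then show False using infinite_Ici by blast
  qed
  then show ?thesis using p q by simp
qed

lemma polyfun_coeff_cycle_poly: "polyfun (\<lambda>L. coeff (cycle_poly m L j) i)"
proof -
  have "polyfun (\<lambda>L. coeff (if even (j * d) then [:L ^ (m div d):] else monom 1 (m div d div 2)) i)" for d
  proof (cases "even (j * d)")
    case True
    then show ?thesis by (cases i) (auto intro: polyfun_intros)
  qed (simp add: polyfun_const)
  then show ?thesis
    unfolding cycle_poly_def coeff_sum coeff_smult by (intro polyfun_intros)
qed

lemma polyfun_coeff_necklace_poly: "polyfun (\<lambda>L. coeff (necklace_poly m L r) i)"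
proof (induction r arbitrary: i rule: less_induct)
  case (less r)
  show ?case
  proof (cases r)
    case (Suc q)
    show ?thesis
      unfolding Suc necklace_poly.simps coeff_smult coeff_sum coeff_mult
      using less Suc by (intro polyfun_intros polyfun_coeff_cycle_poly) simp
  qed (simp add: polyfun_const)
qed

lemma degree_cycle_poly:
  assumes "m > 0"
  shows "degree (cycle_poly m L j) \<le> m"
  unfolding cycle_poly_def
proof (rule degree_sum_le)
  show "finite {d. d dvd m}" using assms by simp
  fix d
  have "degree (monom (1::real) (m div d div 2)) \<le> m"
    using degree_monom_le[of "1::real" "m div d div 2"] div_le_dividend[of m d]
      div_le_dividend[of "m div d" 2] by linarith
  then show "degree (smult (of_int (moebius d))
      (if even (j * d) then [:L ^ (m div d):] else monom 1 (m div d div 2))) \<le> m"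
    by (intro order.trans[OF degree_smult_le]) simp
qed

text \<open>A crude bound, wanted only for a summation range that does not depend on
  \<open>L\<close>.\<close>

lemma degree_necklace_poly:
  assumes m: "m > 0"
  shows "degree (necklace_poly m L r) \<le> m * r"
proof (induction r rule: less_induct)
  case (less r)
  show ?case
  proof (cases r)
    case (Suc q)
    have "degree (cycle_poly m L (Suc j) * necklace_poly m L (q - j)) \<le> m * r" if "j \<le> q" for j
    proof -
      have "degree (necklace_poly m L (q - j)) \<le> m * (q - j)" using less Suc by simp
      moreover have "m + m * (q - j) \<le> m * r"
        using Suc that by (simp flip: mult_Suc_right)
      ultimately show ?thesis
        using degree_mult_le[of "cycle_poly m L (Suc j)" "necklace_poly m L (q - j)"]
          degree_cycle_poly[OF m, of L "Suc j"] by linarith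
    qed
    then show ?thesis
      unfolding Suc necklace_poly.simps
      by (intro order.trans[OF degree_smult_le] degree_sum_le) (auto simp: Suc)
  qed simp
qed

section \<open>Hyperbolic series and averages over signs\<close>

definition fps_cosh :: "real fps" where
  "fps_cosh = fps_const (1/2) * (fps_exp 1 + fps_exp (-1))"

definition fps_sinh :: "real fps" where
  "fps_sinh = fps_const (1/2) * (fps_exp 1 - fps_exp (-1))"

lemma fps_cosh_nth: "fps_cosh $ n = (if even n then 1 / fact n else 0)"
  by (simp add: fps_cosh_def minus_one_power_iff)

lemma fps_sinh_sq: "fps_sinh\<^sup>2 = fps_cosh\<^sup>2 - 1"
proof -
  have e: "fps_exp 1 * fps_exp (- 1 :: real) = 1"
    by (subst fps_exp_add_mult[symmetric]) simp
  have c: "fps_const (1/2 :: real) * 2 = 1"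
    by (metis fps_const_mult fps_const_1_eq_1 fps_numeral_fps_const nonzero_eq_divide_eq zero_neq_numeral)
  have "fps_cosh\<^sup>2 - fps_sinh\<^sup>2 =
      (fps_const (1/2) * 2)\<^sup>2 * (fps_exp 1 * fps_exp (-1))"
    unfolding fps_cosh_def fps_sinh_def by (simp add: power2_eq_square algebra_simps)
  then have "fps_cosh\<^sup>2 - fps_sinh\<^sup>2 = 1" unfolding e c by simp
  then show ?thesis by (simp add: algebra_simps)
qed

lemma fps_exp_sum: "fps_exp (\<Sum>a\<in>A. x a) = (\<Prod>a\<in>A. fps_exp (x a :: real))"
  by (induction A rule: infinite_finite_induct) (simp_all add: fps_exp_add_mult)

text \<open>The exponential generating function of the moments factors over the letters. A letter
  sums to \<open>2 cosh\<close>, or to \<open>2 sinh\<close> if its sign is also a factor of the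
  weight.\<close>

lemma sum_signs_power:
  assumes A: "finite A" and T: "T \<subseteq> A"
  shows "(\<Sum>x\<in>A \<rightarrow>\<^sub>E {1, -1}. (\<Prod>a\<in>T. x a) * (\<Sum>a\<in>A. x a) ^ n) =
    2 ^ card A * fact n * (fps_sinh ^ card T * fps_cosh ^ (card A - card T)) $ n"
proof -
  let ?g = "\<lambda>a y. (if a \<in> T then fps_const y else 1) * fps_exp (y::real)"
  have "(\<Sum>x\<in>A \<rightarrow>\<^sub>E {1, -1}. fps_const (\<Prod>a\<in>T. x a) * fps_exp (\<Sum>a\<in>A. x a)) =
      (\<Sum>x\<in>A \<rightarrow>\<^sub>E {1, -1}. \<Prod>a\<in>A. ?g a (x a))"
  proof (rule sum.cong[OF refl])
    fix x :: "'a \<Rightarrow> real"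
    have "fps_const (\<Prod>a\<in>T. x a) = (\<Prod>a\<in>T. fps_const (x a))"
      by (induction T rule: infinite_finite_induct) (simp_all flip: fps_const_mult)
    also have "\<dots> = (\<Prod>a\<in>A. if a \<in> T then fps_const (x a) else 1)"
      using A T by (simp add: prod.If_cases Int_absorb1)
    finally show "fps_const (\<Prod>a\<in>T. x a) * fps_exp (\<Sum>a\<in>A. x a) = (\<Prod>a\<in>A. ?g a (x a))"
      by (simp add: fps_exp_sum prod.distrib)
  qed
  also have "\<dots> = (\<Prod>a\<in>A. \<Sum>y\<in>{1, -1}. ?g a y)"
    by (rule prod_sum_PiE[symmetric]) (use A in auto)
  also have "\<dots> = (\<Prod>a\<in>A. fps_const 2 * (if a \<in> T then fps_sinh else fps_cosh))"
    by (rule prod.cong[OF refl])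
      (simp add: fps_sinh_def fps_cosh_def mult.assoc[symmetric] flip: fps_const_neg)
  also have "\<dots> = fps_const (2 ^ card A) * (fps_sinh ^ card T * fps_cosh ^ (card A - card T))"
  proof -
    have "A \<inter> - {x. x \<in> T} = A - T" by auto
    then show ?thesis using A T
      by (simp add: prod.distrib prod.If_cases Int_absorb1 card_Diff_subset finite_subset)
  qed
  finally have eq: "(\<Sum>x\<in>A \<rightarrow>\<^sub>E {1, -1}. fps_const (\<Prod>a\<in>T. x a) * fps_exp (\<Sum>a\<in>A. x a)) =
      fps_const (2 ^ card A) * (fps_sinh ^ card T * fps_cosh ^ (card A - card T))" .
  have "(\<Sum>x\<in>A \<rightarrow>\<^sub>E {1, -1 :: real}. (\<Prod>a\<in>T. x a) * (\<Sum>a\<in>A. x a) ^ n) =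
      fact n * (\<Sum>x\<in>A \<rightarrow>\<^sub>E {1, -1}. fps_const (\<Prod>a\<in>T. x a) * fps_exp (\<Sum>a\<in>A. x a)) $ n"
  proof -
    have "c * s = fact n * (c * (s / of_nat (fact n)))" for c s :: real by simp
    then show ?thesis
      unfolding fps_sum_nth sum_distrib_left fps_mult_left_const_nth fps_exp_nth by (rule sum.cong[OF refl])
  qed
  then show ?thesis by (simp add: eq)
qed

text \<open>The sum factors over the letters, and the two signs of a letter add up to 2 or cancel
  according to the parity of its exponent.\<close>

lemma sum_signs_fibres:
  assumes A: "finite A" and T: "T \<subseteq> A" and I: "finite I" and f: "f ` I \<subseteq> A"
  shows "(\<Sum>x\<in>A \<rightarrow>\<^sub>E {1, -1}. (\<Prod>a\<in>T. x a) * (\<Prod>i\<in>I. x (f i))) =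
    (if \<forall>a\<in>A. even (card {i \<in> I. f i = a} + (if a \<in> T then 1 else 0)) then 2 ^ card A else 0 :: real)"
proof -
  define e where "e a = card {i \<in> I. f i = a} + (if a \<in> T then 1 else 0)" for a
  have "(\<Sum>x\<in>A \<rightarrow>\<^sub>E {1, -1}. (\<Prod>a\<in>T. x a) * (\<Prod>i\<in>I. x (f i))) =
      (\<Sum>x\<in>A \<rightarrow>\<^sub>E {1, -1}. \<Prod>a\<in>A. x a ^ e a :: real)"
  proof (rule sum.cong[OF refl])
    fix x :: "'a \<Rightarrow> real"
    have "(\<Prod>a\<in>T. x a) = (\<Prod>a\<in>A. x a ^ (if a \<in> T then 1 else 0))"
      by (rule prod.mono_neutral_cong_left) (use A T in auto)
    moreover have "(\<Prod>i\<in>I. x (f i)) = (\<Prod>a\<in>A. x a ^ card {i \<in> I. f i = a})"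
      by (subst prod.group[OF I A f, symmetric]) simp
    ultimately show "(\<Prod>a\<in>T. x a) * (\<Prod>i\<in>I. x (f i)) = (\<Prod>a\<in>A. x a ^ e a)"
      by (simp add: e_def power_add prod.distrib mult.commute)
  qed
  also have "\<dots> = (\<Prod>a\<in>A. \<Sum>y\<in>{1, -1}. y ^ e a)"
    by (rule prod_sum_PiE[symmetric]) (use A in auto)
  also have "\<dots> = (\<Prod>a\<in>A. if even (e a) then 2 else 0)"
    by (rule prod.cong) (auto simp: minus_one_power_iff)
  also have "\<dots> = (if \<forall>a\<in>A. even (e a) then 2 ^ card A else 0)"
    using A by auto
  finally show ?thesis unfolding e_def .
qed

lemma finite_gr_pairs: "m > 0 \<Longrightarrow> finite A \<Longrightarrow> finite (gr_pairs m A r)"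
  using bij_betw_finite[OF bij_betw_gr_mset] finite_necklace_msets by metis

text \<open>The sign sum of the total weight, computed twice. Over pairs it selects those with the
  prescribed parities; as a polynomial in the squared letter sum it is a combination of moments.
  \<open>T\<close> will be empty for reverse alternating permutations and \<open>{1, l}\<close> for
  alternating ones.\<close>

lemma card_gr_pairs_parity:
  fixes A :: "'a::linorder set"
  assumes A: "finite A" and T: "T \<subseteq> A" and m: "even m" "m > 0"
  shows "real (card {(p, f) \<in> gr_pairs m A r.
      \<forall>a\<in>A. even (card {i \<in> {1..m * r}. f i = a} + (if a \<in> T then 1 else 0))}) =
    (\<Sum>i\<le>m * r. coeff (necklace_poly m (real (card A)) r) i *
      (fact (2 * i) * (fps_sinh ^ card T * fps_cosh ^ (card A - card T)) $ (2 * i)))"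
    (is "real (card ?C) = ?R")
proof -
  let ?X = "A \<rightarrow>\<^sub>E {1, -1 :: real}" and ?G = "gr_pairs m A r"
  let ?P = "\<lambda>f. \<forall>a\<in>A. even (card {i \<in> {1..m * r}. f i = a} + (if a \<in> T then 1 else 0))"
  have "(\<Sum>x\<in>?X. (\<Prod>a\<in>T. x a) * necklace_sum m A x r) =
      (\<Sum>x\<in>?X. \<Sum>(p, f)\<in>?G. (\<Prod>a\<in>T. x a) * (\<Prod>i=1..m * r. x (f i)))"
    by (simp add: sum_gr_pairs[OF m(2), symmetric] sum_distrib_left case_prod_unfold)
  also have "\<dots> = (\<Sum>(p, f)\<in>?G. \<Sum>x\<in>?X. (\<Prod>a\<in>T. x a) * (\<Prod>i=1..m * r. x (f i)))"
    unfolding case_prod_unfold by (rule sum.swap)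
  also have "\<dots> = (\<Sum>(p, f)\<in>?G. if ?P f then 2 ^ card A else 0)"
  proof (rule sum.cong[OF refl], clarify)
    fix p f assume "(p, f) \<in> ?G"
    then have "f ` {1..m * r} \<subseteq> A" by (auto simp: gr_pairs_def)
    then show "(\<Sum>x\<in>?X. (\<Prod>a\<in>T. x a) * (\<Prod>i=1..m * r. x (f i))) = (if ?P f then 2 ^ card A else 0)"
      by (rule sum_signs_fibres[OF A T finite_atLeastAtMost])
  qed
  also have "\<dots> = (\<Sum>(p, f)\<in>?C. 2 ^ card A)"
  proof -
    have "?C = {x \<in> ?G. ?P (snd x)}" by (rule set_eqI) (simp add: case_prod_unfold)
    then have "(\<Sum>x\<in>?C. 2 ^ card A) = (\<Sum>x\<in>?G. if ?P (snd x) then 2 ^ card A else 0 :: real)"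
      by (simp only: sum.inter_filter[OF finite_gr_pairs[OF m(2) A]])
    then show ?thesis unfolding case_prod_unfold by simp
  qed
  finally have l: "(\<Sum>x\<in>?X. (\<Prod>a\<in>T. x a) * necklace_sum m A x r) = 2 ^ card A * real (card ?C)"
    by (simp add: case_prod_unfold)
  have "(\<Sum>x\<in>?X. (\<Prod>a\<in>T. x a) * necklace_sum m A x r) =
      (\<Sum>x\<in>?X. \<Sum>i\<le>m * r. coeff (necklace_poly m (real (card A)) r) i *
        ((\<Prod>a\<in>T. x a) * (\<Sum>a\<in>A. x a) ^ (2 * i)))"
  proof (rule sum.cong[OF refl])
    fix x assume "x \<in> ?X"
    then have x: "\<And>a. a \<in> A \<Longrightarrow> x a \<in> {1, -1}" by blast
    let ?p = "necklace_poly m (real (card A)) r"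
    have "poly ?p ((\<Sum>a\<in>A. x a)\<^sup>2) = (\<Sum>i\<le>m * r. coeff ?p i * ((\<Sum>a\<in>A. x a)\<^sup>2) ^ i)"
      unfolding poly_altdef
      by (rule sum.mono_neutral_left) (use degree_necklace_poly[OF m(2)] in \<open>auto simp: coeff_eq_0\<close>)
    moreover have "poly ?p ((\<Sum>a\<in>A. x a)\<^sup>2) = necklace_sum m A x r"
      by (rule poly_necklace_poly[OF A x m])
    ultimately have "necklace_sum m A x r = (\<Sum>i\<le>m * r. coeff ?p i * (\<Sum>a\<in>A. x a) ^ (2 * i))"
      by (simp only: power_mult)
    then show "(\<Prod>a\<in>T. x a) * necklace_sum m A x r =
        (\<Sum>i\<le>m * r. coeff ?p i * ((\<Prod>a\<in>T. x a) * (\<Sum>a\<in>A. x a) ^ (2 * i)))"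
      by (simp add: sum_distrib_left mult_ac)
  qed
  also have "\<dots> = (\<Sum>i\<le>m * r. coeff (necklace_poly m (real (card A)) r) i *
      (\<Sum>x\<in>?X. (\<Prod>a\<in>T. x a) * (\<Sum>a\<in>A. x a) ^ (2 * i)))"
    by (subst sum.swap) (simp add: sum_distrib_left)
  also have "\<dots> = 2 ^ card A * ?R"
    unfolding sum_signs_power[OF A T] by (simp add: sum_distrib_left mult_ac)
  finally show ?thesis using l by simp
qed

text \<open>Defined through the binomial series so that each coefficient is visibly a polynomial in
  the exponent \<open>c\<close>.\<close>

definition cosh_power :: "real \<Rightarrow> real fps" where
  "cosh_power c = fps_binomial c oo (fps_cosh - 1)"

lemma cosh_power_of_nat: "cosh_power (real n) = fps_cosh ^ n"
  unfolding cosh_power_def fps_binomial_of_nat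
  by (subst fps_compose_power[symmetric]) (simp_all add: fps_compose_add_distrib fps_cosh_nth)

lemma cosh_power_minus_1: "cosh_power (-1) = inverse fps_cosh"
  unfolding cosh_power_def fps_binomial_minus_one
  by (subst fps_inverse_compose) (simp_all add: fps_compose_add_distrib fps_cosh_nth)

lemma polyfun_cosh_power: "polyfun f \<Longrightarrow> polyfun (\<lambda>L. (g * cosh_power (f L)) $ n)"
  unfolding cosh_power_def fps_mult_nth fps_compose_nth fps_binomial_nth
  by (intro polyfun_intros)

text \<open>Formally \<open>1 / cosh x = sec (i x)\<close>, and \<open>tan\<close>, being odd,
  contributes nothing to the Euler numbers of even index.\<close>

lemma inverse_cosh_nth:
  "fact (2 * i) * inverse fps_cosh $ (2 * i) = (-1) ^ i * euler_number (2 * i)"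
proof -
  let ?S = "inverse (fps_cos (1::real))"
  \<comment> \<open>\<open>S\<close> is \<open>sec\<close> with its argument multiplied by the
    imaginary unit, written out over the reals. The signs factor out of the convolution, so
    \<open>cos * sec = 1\<close> becomes \<open>cosh * S = 1\<close>.\<close>
  define S where "S = Abs_fps (\<lambda>n. if even n then (-1) ^ (n div 2) * ?S $ n else 0)"
  have cosS: "fps_cos 1 * ?S = 1" by (rule inverse_mult_eq_1') simp
  have "fps_cosh * S = 1"
  proof (rule fps_ext)
    fix n
    have "(fps_cosh * S) $ n = (\<Sum>k=0..n. (if even n then (-1) ^ (n div 2) else 0) * (fps_cos 1 $ k * ?S $ (n - k)))"
      unfolding fps_mult_nth
    proof (rule sum.cong[OF refl])
      fix k assume k: "k \<in> {0..n}"
      show "fps_cosh $ k * S $ (n - k) =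
          (if even n then (-1) ^ (n div 2) else 0) * (fps_cos 1 $ k * ?S $ (n - k))"
      proof (cases "even k \<and> even n")
        case True
        then obtain a b where "k = 2 * a" "n = 2 * b" by (elim conjE evenE)
        then have "n div 2 = k div 2 + (n - k) div 2" using k by simp
        then have "(-1::real) ^ (n div 2) * (-1) ^ (k div 2) = (-1) ^ ((n - k) div 2)"
          by (simp add: power_add)
        then show ?thesis using True by (simp add: fps_cosh_nth S_def fps_cos_def)
      next
        case False
        then consider "odd k" | "even k" "odd n" by blast
        then show ?thesis
          by cases (use k in \<open>simp_all add: fps_cosh_nth S_def fps_cos_def\<close>)
      qed
    qed
    also have "\<dots> = (if even n then (-1) ^ (n div 2) else 0) * (fps_cos 1 * ?S) $ n"
      by (simp add: fps_mult_nth sum_distrib_left)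
    finally show "(fps_cosh * S) $ n = 1 $ n" unfolding cosS by simp
  qed
  then have S: "inverse fps_cosh = S"
    by (metis fps_inverse_unique mult.commute)
  have "fps_tan (1::real) $ n = 0" if "even n" for n
    using that
  proof (induction n rule: less_induct)
    case (less n)
    have "fps_cos 1 * fps_tan (1::real) = fps_sin 1"
      by (simp add: fps_tan_def)
    then have "(\<Sum>k=0..n. fps_cos 1 $ k * fps_tan (1::real) $ (n - k)) = 0"
      using less.prems by (simp add: fps_mult_nth[symmetric] fps_sin_def)
    moreover have "(\<Sum>k\<in>{0<..n}. fps_cos 1 $ k * fps_tan (1::real) $ (n - k)) = 0"
      using less by (intro sum.neutral) (auto simp: fps_cos_def)
    ultimately show ?case
      by (simp add: sum.head)
  qed
  then show ?thesis by (simp add: S S_def euler_number_def)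
qed

section \<open>Alternating permutations with cycles of equal length\<close>

definition uniform_perms :: "nat \<Rightarrow> nat \<Rightarrow> (nat \<Rightarrow> nat) set" where
  "uniform_perms m r = {p. p permutes {1..m * r} \<and> uniform_cycles m {1..m * r} p}"

lemma finite_uniform_perms: "finite (uniform_perms m r)"
  by (rule finite_subset[OF _ finite_permutations[of "{1..m * r}"]]) (auto simp: uniform_perms_def)

abbreviation ascents :: "(nat \<Rightarrow> nat) \<Rightarrow> nat set" where
  "ascents p \<equiv> {i. p i < p (Suc i)}"

lemma stepped_words_le:
  assumes f: "f \<in> stepped_words S E W n v" and i: "i \<in> {1..n}"
  shows "f i \<le> v"
proof -
  have "f i \<le> f n"
    using i(1)[THEN atLeastAtMost_iff[THEN iffD1, THEN conjunct2]]
  proof (induction rule: inc_induct)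
    case (step k)
    then have "k \<in> {1..<n}" using i by simp
    then have "chain_step E W k (f k) (f (Suc k))" using f by (auto simp: stepped_words_def)
    then show ?case using step.IH by (auto simp: chain_step_def split: if_splits)
  qed simp
  then show ?thesis using f by (simp add: stepped_words_def)
qed

text \<open>A tie of \<open>f\<close> at neighbours is allowed only where \<open>p\<close> ascends.
  Hence forced ties impose ascents on \<open>p\<close>, and elsewhere a step is weak at an ascent of
  \<open>p\<close> and strict otherwise.\<close>

lemma gr_chain_iff:
  fixes f p :: "nat \<Rightarrow> nat"
  shows "(mono_on {1..n} f \<and> (\<forall>i\<in>{1..n}. \<forall>j\<in>{1..n}. i < j \<and> f i = f j \<longrightarrow> p i < p j) \<and>
      (\<forall>i\<in>{1..<n}. i \<in> E \<longrightarrow> f i = f (Suc i))) \<longleftrightarrow>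
    (\<forall>i\<in>{1..<n}. i \<in> E \<longrightarrow> p i < p (Suc i)) \<and>
    (\<forall>i\<in>{1..<n}. chain_step E (ascents p) i (f i) (f (Suc i)))"
  unfolding conj_assoc[symmetric] mono_on_interval_iff chain_step_def
  by (auto simp: order_le_less)

text \<open>Even level sets force ties at all odd positions, hence ascents of \<open>p\<close>
  there. For such a \<open>p\<close> the first letter is free, and the \<open>n div 2 - 1\<close>
  even positions below \<open>n\<close> carry the remaining steps.\<close>

lemma card_gr_pairs_even:
  assumes m: "even m" "m > 0" and r: "r > 0" and l: "l \<ge> 1"
  shows "card {(p, f) \<in> gr_pairs m {1..l} r. \<forall>a\<in>{1..l}. even (card {i \<in> {1..m * r}. f i = a})} =
    (\<Sum>p\<in>{p \<in> uniform_perms m r. \<forall>i\<in>{1..<m * r}. odd i \<longrightarrow> p i < p (Suc i)}.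
      (l + card {i \<in> {1..<m * r}. even i \<and> p i < p (Suc i)}) choose (m * r div 2))"
proof -
  define n where "n = m * r"
  have n: "even n" "n \<ge> 2" using m r by (auto simp: n_def elim!: evenE)
  let ?P = "{p \<in> uniform_perms m r. \<forall>i\<in>{1..<n}. odd i \<longrightarrow> p i < p (Suc i)}"
  let ?S = "\<lambda>p. \<Union>v\<in>{1..l}. stepped_words {1..} (Collect odd) (ascents p) n v"
  have "{(p, f) \<in> gr_pairs m {1..l} r. \<forall>a\<in>{1..l}. even (card {i \<in> {1..n}. f i = a})} = Sigma ?P ?S"
  proof (rule set_eqI, clarify)
    fix p f
    have range: "f \<in> {1..n} \<rightarrow>\<^sub>E {1..l}" if f: "f \<in> ?S p"
    proof -
      obtain v where v: "v \<in> {1..l}" "f \<in> stepped_words {1..} (Collect odd) (ascents p) n v"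
        using f by blast
      have "f i \<le> l" if "i \<in> {1..n}" for i using stepped_words_le[OF v(2) that] v(1) by simp
      then show ?thesis using v(2) by (auto simp: stepped_words_def PiE_def Pi_def)
    qed
    show "(p, f) \<in> {(p, f) \<in> gr_pairs m {1..l} r. \<forall>a\<in>{1..l}. even (card {i \<in> {1..n}. f i = a})} \<longleftrightarrow>
        (p, f) \<in> Sigma ?P ?S"
    proof (cases "f \<in> {1..n} \<rightarrow>\<^sub>E {1..l}")
      case False
      then show ?thesis using range by (auto simp: gr_pairs_def n_def[symmetric])
    next
      case True
      have "(\<forall>a\<in>{1..l}. even (card {i \<in> {1..n}. f i = a})) \<longleftrightarrow>
          (\<forall>i\<in>{1..<n}. odd i \<longrightarrow> f i = f (Suc i))" if "mono_on {1..n} f"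
        using fibres_even_iff[OF _ that n(1), of l] True by blast
      then have "(p, f) \<in> {(p, f) \<in> gr_pairs m {1..l} r. \<forall>a\<in>{1..l}. even (card {i \<in> {1..n}. f i = a})} \<longleftrightarrow>
          p \<in> uniform_perms m r \<and> mono_on {1..n} f \<and>
          (\<forall>i\<in>{1..n}. \<forall>j\<in>{1..n}. i < j \<and> f i = f j \<longrightarrow> p i < p j) \<and>
          (\<forall>i\<in>{1..<n}. i \<in> Collect odd \<longrightarrow> f i = f (Suc i))"
        using True by (auto simp: gr_pairs_def uniform_perms_def n_def[symmetric])
      also have "\<dots> \<longleftrightarrow> p \<in> ?P \<and> (\<forall>i\<in>{1..<n}. chain_step (Collect odd) (ascents p) i (f i) (f (Suc i)))"
        unfolding gr_chain_iff by auto
      also have "\<dots> \<longleftrightarrow> (p, f) \<in> Sigma ?P ?S"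
      proof -
        have "f 1 \<ge> 1" "f n \<in> {1..l}" "f \<in> {1..n} \<rightarrow>\<^sub>E {1..}"
          using True n by (auto simp: PiE_def Pi_def)
        then show ?thesis by (auto simp: stepped_words_def)
      qed
      finally show ?thesis .
    qed
  qed
  then have "card {(p, f) \<in> gr_pairs m {1..l} r. \<forall>a\<in>{1..l}. even (card {i \<in> {1..n}. f i = a})} =
      (\<Sum>p\<in>?P. card (?S p))"
    using n finite_uniform_perms by (simp add: card_SigmaI finite_stepped_words)
  also have "\<dots> = (\<Sum>p\<in>?P. (l + card {i \<in> {1..<n}. even i \<and> p i < p (Suc i)}) choose (n div 2))"
  proof (rule sum.cong[OF refl])
    fix p
    have "card (?S p) = (\<Sum>v=1..l. card (stepped_words {1..} (Collect odd) (ascents p) n v))"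
    proof (rule card_UN_disjoint)
      show "\<forall>v\<in>{1..l}. finite (stepped_words {1..} (Collect odd) (ascents p) n v)"
        using n by (simp add: finite_stepped_words)
    qed (auto simp: stepped_words_def)
    also have "\<dots> = (l + 1 - 1 + card {i \<in> {1..<n}. i \<notin> Collect odd \<and> i \<in> ascents p}) choose
        (card {i \<in> {1..<n}. i \<notin> Collect odd} + 1)"
    proof (rule sum_card_stepped_words)
      fix v :: nat
      have "{1..v} \<inter> {1..} = {1..v}" by auto
      then show "card ({1..v} \<inter> {1..}) = (v + 1 - 1) choose 1" by simp
    qed (use n l in auto)
    also have "card {i \<in> {1..<n}. i \<notin> Collect odd} + 1 = n div 2"
    proof -
      have "{i \<in> {1..<n}. i \<notin> Collect odd} = (\<lambda>i. 2 * i) ` {1..<n div 2}"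
        using n(1) by (auto elim!: evenE)
      then have "card {i \<in> {1..<n}. i \<notin> Collect odd} = n div 2 - 1"
        by (simp add: card_image inj_on_def)
      then show ?thesis using n by simp
    qed
    finally show "card (?S p) = (l + card {i \<in> {1..<n}. even i \<and> p i < p (Suc i)}) choose (n div 2)"
      by simp
  qed
  finally show ?thesis unfolding n_def .
qed

text \<open>Now the ties sit at the even positions and both end letters are prescribed, so only the
  odd positions carry steps.\<close>

lemma card_gr_pairs_odd_ends:
  assumes m: "even m" "m > 0" and r: "r > 0" and l: "l \<ge> 2"
  shows "card {(p, f) \<in> gr_pairs m {1..l} r.
      \<forall>a\<in>{1..l}. even (card {i \<in> {1..m * r}. f i = a} + (if a \<in> {1, l} then 1 else 0))} =
    (\<Sum>p\<in>{p \<in> uniform_perms m r. \<forall>i\<in>{1..<m * r}. even i \<longrightarrow> p i < p (Suc i)}.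
      (l - 2 + card {i \<in> {1..<m * r}. odd i \<and> p i < p (Suc i)}) choose (m * r div 2 - 1))"
proof -
  define n where "n = m * r"
  have n: "even n" "n \<ge> 2" using m r by (auto simp: n_def elim!: evenE)
  let ?par = "\<lambda>f. \<forall>a\<in>{1..l}. even (card {i \<in> {1..n}. f i = a} + (if a \<in> {1, l} then 1 else 0))"
  let ?P = "{p \<in> uniform_perms m r. \<forall>i\<in>{1..<n}. even i \<longrightarrow> p i < p (Suc i)}"
  let ?S = "\<lambda>p. stepped_words {1} (Collect even) (ascents p) n l"
  have "{(p, f) \<in> gr_pairs m {1..l} r. ?par f} = Sigma ?P ?S"
  proof (rule set_eqI, clarify)
    fix p f
    have range: "f \<in> {1..n} \<rightarrow>\<^sub>E {1..l}" if "f \<in> ?S p"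
      using that stepped_words_le[OF that] by (auto simp: stepped_words_def PiE_def Pi_def)
    show "(p, f) \<in> {(p, f) \<in> gr_pairs m {1..l} r. ?par f} \<longleftrightarrow> (p, f) \<in> Sigma ?P ?S"
    proof (cases "f \<in> {1..n} \<rightarrow>\<^sub>E {1..l}")
      case False
      then show ?thesis using range by (auto simp: gr_pairs_def n_def[symmetric])
    next
      case True
      have "?par f \<longleftrightarrow> f 1 = 1 \<and> f n = l \<and> (\<forall>i\<in>{1..<n}. even i \<longrightarrow> f i = f (Suc i))"
        if "mono_on {1..n} f"
        by (rule fibres_odd_ends_iff) (use True that n l in auto)
      then have "(p, f) \<in> {(p, f) \<in> gr_pairs m {1..l} r. ?par f} \<longleftrightarrow>
          p \<in> uniform_perms m r \<and> f 1 = 1 \<and> f n = l \<and> mono_on {1..n} f \<and>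
          (\<forall>i\<in>{1..n}. \<forall>j\<in>{1..n}. i < j \<and> f i = f j \<longrightarrow> p i < p j) \<and>
          (\<forall>i\<in>{1..<n}. i \<in> Collect even \<longrightarrow> f i = f (Suc i))"
        using True unfolding gr_pairs_def uniform_perms_def n_def[symmetric] mem_Collect_eq case_prod_conv by blast
      also have "\<dots> \<longleftrightarrow> p \<in> ?P \<and> f 1 = 1 \<and> f n = l \<and>
          (\<forall>i\<in>{1..<n}. chain_step (Collect even) (ascents p) i (f i) (f (Suc i)))"
        unfolding gr_chain_iff by auto
      also have "\<dots> \<longleftrightarrow> (p, f) \<in> Sigma ?P ?S"
      proof -
        have "f \<in> {1..n} \<rightarrow>\<^sub>E {1..}" using True by (auto simp: PiE_def Pi_def)
        then show ?thesis by (auto simp: stepped_words_def)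
      qed
      finally show ?thesis .
    qed
  qed
  then have "card {(p, f) \<in> gr_pairs m {1..l} r. ?par f} = (\<Sum>p\<in>?P. card (?S p))"
    using n l finite_uniform_perms by (simp add: card_SigmaI finite_stepped_words)
  also have "\<dots> = (\<Sum>p\<in>?P. (l - 2 + card {i \<in> {1..<n}. odd i \<and> p i < p (Suc i)}) choose (n div 2 - 1))"
  proof (rule sum.cong[OF refl])
    fix p
    \<comment> \<open>The last letter is exactly \<open>l\<close> rather than at most
      \<open>l\<close>. The summation formula is therefore used up to position
      \<open>k = n - 1\<close>, and the last step is added by hand: it sums to \<open>l\<close> if
      weak and to \<open>l - 1\<close> if strict.\<close>
    obtain k where k: "n = Suc k" "k \<ge> 1" "odd k" using n by (cases n) auto
    let ?a = "card {i \<in> {1..<k}. i \<notin> Collect even \<and> i \<in> ascents p}"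
    have q: "card {i \<in> {1..<k}. i \<notin> Collect even} = n div 2 - 1"
    proof -
      have "{i \<in> {1..<k}. i \<notin> Collect even} = (\<lambda>i. 2 * i + 1) ` {..<n div 2 - 1}"
        using k by (auto elim!: oddE)
      then show ?thesis by (simp add: card_image inj_on_def)
    qed
    have T: "(\<Sum>u=1..v. card (stepped_words {1} (Collect even) (ascents p) k u)) =
        (v - 1 + ?a) choose (n div 2 - 1)" if "v \<ge> 1" for v
    proof -
      have "(\<Sum>u=1..v. card (stepped_words {1} (Collect even) (ascents p) k u)) =
          (v + 0 - 1 + ?a) choose (card {i \<in> {1..<k}. i \<notin> Collect even} + 0)"
        by (rule sum_card_stepped_words) (use k that in auto)
      then show ?thesis unfolding q by simp
    qed
    have S: "{i \<in> {1..<n}. odd i \<and> p i < p (Suc i)} =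
        (if k \<in> ascents p then insert k {i \<in> {1..<k}. i \<notin> Collect even \<and> i \<in> ascents p}
         else {i \<in> {1..<k}. i \<notin> Collect even \<and> i \<in> ascents p})"
      using k by (auto simp: less_Suc_eq)
    have a: "card {i \<in> {1..<n}. odd i \<and> p i < p (Suc i)} = (if k \<in> ascents p then Suc ?a else ?a)"
      unfolding S by simp
    have "card (?S p) = (if k \<in> ascents p then (l - 1 + ?a) choose (n div 2 - 1)
        else (l - 1 - 1 + ?a) choose (n div 2 - 1))"
      unfolding k(1) using k card_stepped_words_Suc[of k l "{1}" "Collect even" "ascents p"] T[of l] T[of "l - 1"] l
      by simp
    also have "\<dots> = (l - 2 + card {i \<in> {1..<n}. odd i \<and> p i < p (Suc i)}) choose (n div 2 - 1)"
      unfolding a using l by (auto simp: numeral_2_eq_2 Suc_diff_Suc)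
    finally show "card (?S p) =
        (l - 2 + card {i \<in> {1..<n}. odd i \<and> p i < p (Suc i)}) choose (n div 2 - 1)" .
  qed
  finally show ?thesis unfolding n_def .
qed

section \<open>Evaluation at \<open>l = -1\<close> and \<open>l = 1\<close>\<close>

lemma minus_one_gbinomial: "(-1 :: real) gchoose k = (-1) ^ k"
  using gbinomial_minus[of "1::real" k] by (simp flip: binomial_gbinomial)

text \<open>For \<open>1 \<le> a \<le> k\<close> the upper argument is a natural number below
  \<open>k\<close>, so the binomial is 0; at \<open>a = 0\<close> it is that of -1. This is what
  singles out the permutations without ascents at the remaining positions.\<close>

lemma gbinomial_pred_nat:
  assumes "a \<le> k"
  shows "(real a - 1) gchoose k = (if a = 0 then (-1) ^ k else 0)"
proof (cases a)
  case (Suc b)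
  then have "(real a - 1) gchoose k = real (b choose k)" by (simp add: binomial_gbinomial)
  then show ?thesis using Suc assms by simp
qed (simp add: minus_one_gbinomial)

lemma card_even_below: "card {i \<in> {1..<n}. even i \<and> P i} \<le> (n - 1) div 2"
proof -
  have "{i \<in> {1..<n}. even i \<and> P i} \<subseteq> (\<lambda>i. 2 * i) ` {1..(n - 1) div 2}"
    by (auto elim!: evenE)
  from card_mono[OF _ this] show ?thesis
    using card_image_le[of "{1..(n - 1) div 2}" "\<lambda>i. 2 * i"] by simp
qed

lemma card_odd_below: "card {i \<in> {1..<n}. odd i \<and> P i} \<le> n div 2"
proof -
  have "{i \<in> {1..<n}. odd i \<and> P i} \<subseteq> (\<lambda>i. 2 * i + 1) ` {..<n div 2}"
    by (auto elim!: oddE)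
  from card_mono[OF _ this] show ?thesis
    using card_image_le[of "{..<n div 2}" "\<lambda>i. 2 * i + 1"] by simp
qed

lemma permutes_not_ascent:
  assumes "p permutes S"
  shows "\<not> p i < p (Suc i) \<longleftrightarrow> p i > p (Suc i)"
proof -
  have "p i \<noteq> p (Suc i)" using permutes_inj[OF assms] by (auto simp: inj_eq)
  then show ?thesis by auto
qed

lemma b_rev_eq_card:
  assumes "m > 0"
  shows "b_rev m r = card {p \<in> uniform_perms m r. reverse_alternating (m * r) p}"
  unfolding b_rev_def uniform_perms_def
  by (rule arg_cong[of _ _ card]) (use cycle_type_uniform_iff[OF _ assms] in auto)

lemma b_alt_eq_card:
  assumes "m > 0"
  shows "b_alt m r = card {p \<in> uniform_perms m r. alternating (m * r) p}"
  unfolding b_alt_def uniform_perms_def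
  by (rule arg_cong[of _ _ card]) (use cycle_type_uniform_iff[OF _ assms] in auto)

lemma b_rev_formula:
  assumes m: "even m" "m > 0" and r: "r > 0"
  shows "real (b_rev m r) = (-1) ^ (m * r div 2) *
    (\<Sum>i\<le>m * r. coeff (necklace_poly m (-1) r) i * ((-1) ^ i * euler_number (2 * i)))"
proof -
  define n where "n = m * r"
  have n: "even n" "n \<ge> 2" using m r by (auto simp: n_def elim!: evenE)
  define k where "k = n div 2"
  let ?P = "{p \<in> uniform_perms m r. \<forall>i\<in>{1..<n}. odd i \<longrightarrow> p i < p (Suc i)}"
  let ?a = "\<lambda>p. card {i \<in> {1..<n}. even i \<and> p i < p (Suc i)}"
  let ?f = "\<lambda>L. \<Sum>i\<le>n. coeff (necklace_poly m L r) i * (fact (2 * i) * (1 * cosh_power L) $ (2 * i))"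
  let ?g = "\<lambda>L. \<Sum>p\<in>?P. (L + real (?a p)) gchoose k"
  have "?f (-1) = ?g (-1)"
  proof (rule polyfun_eqI[where f = ?f and g = ?g])
    show "polyfun ?f"
      by (intro polyfun_sum polyfun_mult polyfun_coeff_necklace_poly polyfun_const polyfun_cosh_power polyfun_id)
    show "polyfun ?g" by (intro polyfun_intros)
    fix l :: nat assume l: "l \<ge> 2"
    have "?f (real l) = real (card {(p, f) \<in> gr_pairs m {1..l} r.
        \<forall>a\<in>{1..l}. even (card {i \<in> {1..m * r}. f i = a} + (if a \<in> {} then 1 else 0))})"
      by (subst card_gr_pairs_parity) (use m in \<open>simp_all add: cosh_power_of_nat n_def\<close>)
    also have "\<dots> = real (card {(p, f) \<in> gr_pairs m {1..l} r.
        \<forall>a\<in>{1..l}. even (card {i \<in> {1..m * r}. f i = a})})" by simp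
    also have "\<dots> = ?g (real l)"
      using l by (subst card_gr_pairs_even[OF m r]) (simp_all add: n_def k_def binomial_gbinomial)
    finally show "?f (real l) = ?g (real l)" .
  qed
  also have "?g (-1) = (\<Sum>p\<in>?P. if ?a p = 0 then (-1) ^ k else 0)"
  proof (rule sum.cong[OF refl])
    fix p
    have "?a p \<le> k" using card_even_below[of n "\<lambda>i. p i < p (Suc i)"] by (simp add: k_def)
    then show "(- 1 + real (?a p)) gchoose k = (if ?a p = 0 then (-1) ^ k else 0)"
      using gbinomial_pred_nat[of "?a p" k] by (simp add: add.commute)
  qed
  also have "\<dots> = (-1) ^ k * real (card {p \<in> ?P. ?a p = 0})"
    using finite_uniform_perms by (simp add: sum.inter_filter[symmetric])
  also have "{p \<in> ?P. ?a p = 0} = {p \<in> uniform_perms m r. reverse_alternating n p}"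
  proof (intro Collect_cong)
    fix p
    show "(p \<in> ?P \<and> ?a p = 0) \<longleftrightarrow> (p \<in> uniform_perms m r \<and> reverse_alternating n p)"
    proof (cases "p \<in> uniform_perms m r")
      case True
      then have "\<not> p i < p (Suc i) \<longleftrightarrow> p i > p (Suc i)" for i
        using permutes_not_ascent by (auto simp: uniform_perms_def)
      then show ?thesis using True by (auto simp: reverse_alternating_def)
    qed simp
  qed
  also have "card \<dots> = b_rev m r" using b_rev_eq_card[OF m(2)] by (simp add: n_def)
  also have "?f (-1) = (\<Sum>i\<le>n. coeff (necklace_poly m (-1) r) i * ((-1) ^ i * euler_number (2 * i)))"
    by (simp add: cosh_power_minus_1 inverse_cosh_nth)
  finally have "(-1) ^ k * (-1) ^ k * real (b_rev m r) = (-1) ^ k *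
      (\<Sum>i\<le>n. coeff (necklace_poly m (-1) r) i * ((-1) ^ i * euler_number (2 * i)))" by simp
  then show ?thesis by (simp add: n_def k_def flip: power_add)
qed

lemma increasing_permutes_fix:
  assumes p: "p permutes {1..n}" and inc: "\<forall>i\<in>{1..<n}. p i < p (Suc i)" and i: "i \<in> {1..n}"
  shows "p i = i"
proof -
  have "strict_mono_on {1..n} p"
  proof (rule strict_mono_onI)
    fix i j assume ij: "i \<in> {1..n}" "j \<in> {1..n}" "i < j"
    from ij(3)[THEN Suc_leI] ij(2) show "p i < p j"
    proof (induction j rule: dec_induct)
      case (step k)
      then have "p i < p k" by auto
      also have "p k < p (Suc k)" using inc step ij(1) by auto
      finally show ?case .
    qed (use inc ij(1) in auto)
  qed
  then show ?thesis
    using strict_mono_bij_unique[of "{1..n}" p id i] i permutes_image[OF p]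
    by (simp add: strict_mono_on_def)
qed

text \<open>At these values every term reduces to \<open>moebius d\<close>: one letter spells no
  primitive word of length above 1. This disposes of the \<open>cosh\<close> term in
  \<open>b_alt_formula\<close>.\<close>

lemma cycle_poly_at_1_1: "m > 1 \<Longrightarrow> poly (cycle_poly m 1 j) 1 = 0"
proof -
  assume m: "m > 1"
  have "poly (cycle_poly m 1 j) 1 = (\<Sum>d | d dvd m. of_int (moebius d))"
    unfolding cycle_poly_def poly_sum by (intro sum.cong) (auto simp: poly_monom)
  then show ?thesis using sum_moebius[of m, where 'b = real] m by simp
qed

text \<open>At \<open>L = 1\<close> the binomial of \<open>card_gr_pairs_odd_ends\<close> has upper
  argument \<open>a - 1\<close>, and the moment series is
  \<open>sinh^2 / cosh = cosh - 1 / cosh\<close>. The even moments of \<open>cosh\<close> are all 1,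
  so its part is the value of the necklace polynomial at 1, which is 0. The minus sign left over is
  absorbed by the lower index \<open>n div 2 - 1\<close>.\<close>

lemma b_alt_formula:
  assumes m: "even m" "m > 0" and r: "r > 0"
  shows "real (b_alt m r) = (-1) ^ (m * r div 2) *
    (\<Sum>i\<le>m * r. coeff (necklace_poly m 1 r) i * ((-1) ^ i * euler_number (2 * i)))"
proof -
  define n where "n = m * r"
  have n: "even n" "n \<ge> 2" using m r by (auto simp: n_def elim!: evenE)
  define k where "k = n div 2 - 1"
  let ?P = "{p \<in> uniform_perms m r. \<forall>i\<in>{1..<n}. even i \<longrightarrow> p i < p (Suc i)}"
  let ?a = "\<lambda>p. card {i \<in> {1..<n}. odd i \<and> p i < p (Suc i)}"
  let ?h = "necklace_poly m 1 r"
  let ?f = "\<lambda>L. \<Sum>i\<le>n. coeff (necklace_poly m L r) i *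
    (fact (2 * i) * (fps_sinh\<^sup>2 * cosh_power (L - 2)) $ (2 * i))"
  let ?g = "\<lambda>L. \<Sum>p\<in>?P. (L - 2 + real (?a p)) gchoose k"
  have "?f 1 = ?g 1"
  proof (rule polyfun_eqI[where f = ?f and g = ?g])
    show "polyfun ?f"
      by (intro polyfun_sum polyfun_mult polyfun_coeff_necklace_poly polyfun_const polyfun_cosh_power
          polyfun_diff polyfun_id)
    show "polyfun ?g" by (intro polyfun_intros)
    fix l :: nat assume l: "l \<ge> 2"
    have c: "card {1, l} = 2" using l by auto
    have rl: "real l - 2 = real (l - 2)" using l by simp
    have "?f (real l) = real (card {(p, f) \<in> gr_pairs m {1..l} r.
        \<forall>a\<in>{1..l}. even (card {i \<in> {1..m * r}. f i = a} + (if a \<in> {1, l} then 1 else 0))})"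
      unfolding rl cosh_power_of_nat
      by (subst card_gr_pairs_parity) (use m l c in \<open>simp_all add: n_def numeral_2_eq_2\<close>)
    also have "\<dots> = ?g (real l)"
      unfolding card_gr_pairs_odd_ends[OF m r l]
      unfolding rl by (simp add: n_def k_def binomial_gbinomial)
    finally show "?f (real l) = ?g (real l)" .
  qed
  also have "?g 1 = (\<Sum>p\<in>?P. if ?a p = 0 then (-1) ^ k else 0)"
  proof (rule sum.cong[OF refl])
    fix p assume p: "p \<in> ?P"
    have le: "?a p \<le> n div 2" by (rule card_odd_below)
    \<comment> \<open>There are \<open>n div 2\<close> odd positions, one more than
      \<open>gbinomial_pred_nat\<close> tolerates. In the extreme case \<open>p\<close> would ascend
      everywhere and fix 1, contradicting cycles of length at least 2.\<close>
    have "?a p \<noteq> n div 2"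
    proof
      assume eq: "?a p = n div 2"
      have fin: "finite ((\<lambda>i. 2 * i + 1) ` {..<n div 2})" by simp
      have sub: "{i \<in> {1..<n}. odd i \<and> p i < p (Suc i)} \<subseteq> (\<lambda>i. 2 * i + 1) ` {..<n div 2}"
        by (auto elim!: oddE)
      have "card ((\<lambda>i. 2 * i + 1) ` {..<n div 2}) = n div 2"
        by (simp add: card_image inj_on_def)
      then have S: "{i \<in> {1..<n}. odd i \<and> p i < p (Suc i)} = (\<lambda>i. 2 * i + 1) ` {..<n div 2}"
        using card_subset_eq[OF fin sub] eq by simp
      have "p i < p (Suc i)" if i: "i \<in> {1..<n}" for i
      proof (cases "even i")
        case False
        then obtain j where j: "i = 2 * j + 1" by (elim oddE)
        then have "i \<in> (\<lambda>i. 2 * i + 1) ` {..<n div 2}" using i n by auto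
        then show ?thesis unfolding S[symmetric] by simp
      qed (use p i in auto)
      then have p1: "p 1 = 1"
        using increasing_permutes_fix[of p n 1] p n by (auto simp: uniform_perms_def n_def)
      have "1 < m" using m by (cases m) (auto intro: Nat.gr0I)
      moreover have "uniform_cycles m {1..n} p" using p by (simp add: uniform_perms_def n_def)
      moreover have "1 \<in> {1..n}" using n(2) by simp
      ultimately have "(p ^^ 1) 1 \<noteq> 1"
        unfolding uniform_cycles_def using zero_less_one by blast
      then show False using p1 by simp
    qed
    then have "?a p \<le> k" using le by (simp add: k_def)
    then show "(1 - 2 + real (?a p)) gchoose k = (if ?a p = 0 then (-1) ^ k else 0)"
      using gbinomial_pred_nat[of "?a p" k] by (simp add: add.commute)
  qed
  also have "\<dots> = (-1) ^ k * real (card {p \<in> ?P. ?a p = 0})"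
    using finite_uniform_perms by (simp add: sum.inter_filter[symmetric])
  also have "{p \<in> ?P. ?a p = 0} = {p \<in> uniform_perms m r. alternating n p}"
  proof (intro Collect_cong)
    fix p
    show "(p \<in> ?P \<and> ?a p = 0) \<longleftrightarrow> (p \<in> uniform_perms m r \<and> alternating n p)"
    proof (cases "p \<in> uniform_perms m r")
      case True
      then have "\<not> p i < p (Suc i) \<longleftrightarrow> p i > p (Suc i)" for i
        using permutes_not_ascent by (auto simp: uniform_perms_def)
      then show ?thesis using True by (auto simp: alternating_def)
    qed simp
  qed
  also have "card \<dots> = b_alt m r" using b_alt_eq_card[OF m(2)] by (simp add: n_def)
  also have "?f 1 = - (\<Sum>i\<le>n. coeff ?h i * ((-1) ^ i * euler_number (2 * i)))"
  proof -
    have "fps_sinh\<^sup>2 * cosh_power (1 - 2) = fps_cosh - inverse fps_cosh"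
    proof -
      have "fps_cosh * inverse fps_cosh = 1"
        by (rule inverse_mult_eq_1') (simp add: fps_cosh_nth)
      moreover have "fps_sinh\<^sup>2 * inverse fps_cosh =
          fps_cosh * (fps_cosh * inverse fps_cosh) - inverse fps_cosh"
        unfolding fps_sinh_sq by (simp add: algebra_simps power2_eq_square)
      ultimately show ?thesis by (simp add: cosh_power_minus_1)
    qed
    then have "fact (2 * i) * (fps_sinh\<^sup>2 * cosh_power (1 - 2)) $ (2 * i) =
        1 - (-1) ^ i * euler_number (2 * i)" for i
      unfolding inverse_cosh_nth[symmetric]
      by (simp only: fps_sub_nth right_diff_distrib) (simp add: fps_cosh_nth)
    then have "?f 1 = (\<Sum>i\<le>n. coeff ?h i * (1 - (-1) ^ i * euler_number (2 * i)))"
      by (simp only:)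
    also have "\<dots> = (\<Sum>i\<le>n. coeff ?h i * 1 ^ i) - (\<Sum>i\<le>n. coeff ?h i * ((-1) ^ i * euler_number (2 * i)))"
      by (simp add: algebra_simps sum_subtractf)
    also have "(\<Sum>i\<le>n. coeff ?h i * 1 ^ i) = poly ?h 1"
      unfolding poly_altdef
      by (rule sum.mono_neutral_right) (use degree_necklace_poly[OF m(2)] in \<open>auto simp: coeff_eq_0 n_def\<close>)
    also have "poly ?h 1 = 0"
    proof -
      have "1 < m" using m by (cases m) (auto intro: Nat.gr0I)
      then show ?thesis using r by (cases r) (simp_all add: poly_sum cycle_poly_at_1_1)
    qed
    finally show ?thesis by simp
  qed
  finally have "- (\<Sum>i\<le>n. coeff ?h i * ((-1) ^ i * euler_number (2 * i))) = (-1) ^ k * real (b_alt m r)" .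
  then have "(\<Sum>i\<le>n. coeff ?h i * ((-1) ^ i * euler_number (2 * i))) = - ((-1) ^ k * real (b_alt m r))"
    by simp
  then have "(-1) ^ Suc k * (\<Sum>i\<le>n. coeff ?h i * ((-1) ^ i * euler_number (2 * i))) =
      (-1) ^ k * (-1) ^ k * real (b_alt m r)" by (simp only:) simp
  moreover have "n div 2 = Suc k" using n by (auto simp: k_def elim!: evenE)
  ultimately show ?thesis by (simp add: n_def flip: power_add)
qed

section \<open>Umbral evaluation\<close>

lemma smult_sum_right: "smult c (\<Sum>i\<in>I. f i) = (\<Sum>i\<in>I. smult c (f i))"
  by (induction I rule: infinite_finite_induct) (simp_all add: smult_add_right)

lemma umbral_eval_eq_sum:
  assumes "degree p \<le> N"
  shows "umbral_eval p = (\<Sum>k\<le>N. coeff p k * euler_number k)"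
  unfolding umbral_eval_def
  by (rule sum.mono_neutral_left) (use assms in \<open>auto simp: coeff_eq_0\<close>)

lemma umbral_eval_add: "umbral_eval (p + q) = umbral_eval p + umbral_eval q"
proof -
  have "umbral_eval f = (\<Sum>k\<le>max (degree p) (degree q). coeff f k * euler_number k)"
    if "f \<in> {p, q, p + q}" for f
    by (rule umbral_eval_eq_sum) (use that degree_add_le_max in auto)
  then show ?thesis by (simp add: algebra_simps sum.distrib)
qed

lemma umbral_eval_smult: "umbral_eval (smult c p) = c * umbral_eval p"
  using umbral_eval_eq_sum[OF degree_smult_le[of c p]]
  by (simp add: umbral_eval_def sum_distrib_left mult.assoc)

lemma umbral_eval_0 [simp]: "umbral_eval 0 = 0"
  by (simp add: umbral_eval_def)

lemma umbral_eval_sum: "umbral_eval (\<Sum>i\<in>I. f i) = (\<Sum>i\<in>I. umbral_eval (f i))"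
  by (induction I rule: infinite_finite_induct) (simp_all add: umbral_eval_add)

lemma umbral_eval_monom: "umbral_eval (monom c k) = c * euler_number k"
proof -
  have "umbral_eval (monom c k) = (\<Sum>i\<le>k. if i = k then c * euler_number k else 0)"
    by (subst umbral_eval_eq_sum[OF degree_monom_le]) (rule sum.cong[OF refl], simp)
  then show ?thesis by simp
qed

text \<open>Substitutes \<open>- E\<^sup>2\<close> for the square of the letter sum, turning moments of \<open>1 / cosh\<close> into
  secant numbers.\<close>

definition subst_neg_sq :: "real poly \<Rightarrow> real poly" where
  "subst_neg_sq p = pcompose p [:0, 0, -1:]"

lemma subst_neg_sq_monom: "subst_neg_sq (monom c k) = monom (c * (-1) ^ k) (2 * k)"
proof (induction k)
  case 0
  then show ?case by (simp add: subst_neg_sq_def monom_0)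
next
  case (Suc k)
  have "[:0, 0, -1:] = monom (-1 :: real) 2" by (simp add: monom_altdef power2_eq_square)
  moreover have "subst_neg_sq (monom c (Suc k)) = [:0, 0, -1:] * subst_neg_sq (monom c k)"
    by (simp add: subst_neg_sq_def monom_Suc pcompose_pCons)
  ultimately have "subst_neg_sq (monom c (Suc k)) = monom (-1) 2 * monom (c * (-1) ^ k) (2 * k)"
    by (simp only: Suc.IH)
  then show ?case by (simp add: mult_monom)
qed

lemma umbral_eval_subst_neg_sq:
  assumes "degree p \<le> N"
  shows "umbral_eval (subst_neg_sq p) = (\<Sum>i\<le>N. coeff p i * ((-1) ^ i * euler_number (2 * i)))"
proof -
  have "p = (\<Sum>i\<le>N. monom (coeff p i) i)"
    by (rule poly_as_sum_of_monoms'[OF assms, symmetric])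
  then have "subst_neg_sq p = subst_neg_sq (\<Sum>i\<le>N. monom (coeff p i) i)"
    by (rule arg_cong)
  also have "\<dots> = (\<Sum>i\<le>N. subst_neg_sq (monom (coeff p i) i))"
    by (simp add: subst_neg_sq_def pcompose_sum)
  finally show ?thesis by (simp add: umbral_eval_sum subst_neg_sq_monom umbral_eval_monom mult.assoc)
qed

definition signed_cycle_poly :: "nat \<Rightarrow> real \<Rightarrow> nat \<Rightarrow> real poly" where
  "signed_cycle_poly m L j = smult ((-1) ^ (m * j div 2)) (subst_neg_sq (cycle_poly m L j))"

text \<open>The formulas for \<open>b_rev\<close> and \<open>b_alt\<close> say that its umbral
  evaluation is \<open>F_rev m\<close> for \<open>L = -1\<close> and \<open>F_alt m\<close> for
  \<open>L = 1\<close>. The global sign is built in here.\<close>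

definition signed_necklace_fps :: "nat \<Rightarrow> real \<Rightarrow> real poly fps" where
  "signed_necklace_fps m L =
     Abs_fps (\<lambda>r. smult ((-1) ^ (m * r div 2)) (subst_neg_sq (necklace_poly m L r)))"

lemma umbral_signed_necklace_fps_nth:
  assumes "m > 0"
  shows "umbral (signed_necklace_fps m L) $ r = (-1) ^ (m * r div 2) *
    (\<Sum>i\<le>m * r. coeff (necklace_poly m L r) i * ((-1) ^ i * euler_number (2 * i)))"
  by (simp add: umbral_def signed_necklace_fps_def umbral_eval_smult
      umbral_eval_subst_neg_sq[OF degree_necklace_poly[OF assms]])

lemma euler_number_0: "euler_number 0 = 1"
  by (simp add: euler_number_def fps_tan_def fps_sin_def fps_divide_unit)

lemma F_rev_umbral:
  assumes m: "even m" "m > 0"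
  shows "F_rev m = umbral (signed_necklace_fps m (-1))"
proof (rule fps_ext)
  fix r
  show "F_rev m $ r = umbral (signed_necklace_fps m (-1)) $ r"
  proof (cases "r = 0")
    case True
    then show ?thesis unfolding umbral_signed_necklace_fps_nth[OF m(2)]
      by (simp add: F_rev_def b_rev_def reverse_alternating_def cycle_type_def euler_number_0)
  qed (simp add: F_rev_def b_rev_formula[OF m] umbral_signed_necklace_fps_nth[OF m(2)])
qed

lemma F_alt_umbral:
  assumes m: "even m" "m > 0"
  shows "F_alt m = umbral (signed_necklace_fps m 1)"
proof (rule fps_ext)
  fix r
  show "F_alt m $ r = umbral (signed_necklace_fps m 1) $ r"
  proof (cases "r = 0")
    case True
    then show ?thesis unfolding umbral_signed_necklace_fps_nth[OF m(2)]
      by (simp add: F_alt_def b_alt_def alternating_def cycle_type_def euler_number_0)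
  qed (simp add: F_alt_def b_alt_formula[OF m] umbral_signed_necklace_fps_nth[OF m(2)])
qed

text \<open>The logarithmic derivative of \<open>signed_necklace_fps\<close>; its coefficients are
  the signed power sums of Newton's recursion.\<close>

definition cycle_fps :: "nat \<Rightarrow> real \<Rightarrow> real poly fps" where
  "cycle_fps m L = Abs_fps (\<lambda>j. smult (1 / real m) (signed_cycle_poly m L (Suc j)))"

lemma signed_necklace_fps_deriv:
  assumes m: "even m" "m > 0"
  shows "fps_deriv (signed_necklace_fps m L) = signed_necklace_fps m L * cycle_fps m L"
proof (rule fps_ext)
  fix r
  let ?s = "\<lambda>r. (-1 :: real) ^ (m * r div 2)"
  \<comment> \<open>As \<open>m\<close> is even, \<open>m * r div 2\<close> is additive in
    \<open>r\<close>, so the signs respect the convolution.\<close>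
  have sgn: "?s (Suc r) = ?s (Suc j) * ?s (r - j)" if "j \<le> r" for j
  proof -
    obtain c where c: "m = 2 * c" using m(1) by (elim evenE)
    have "c * Suc r = c * Suc j + c * (r - j)" using that by (simp flip: distrib_left)
    then show ?thesis by (simp only: c mult.assoc nonzero_mult_div_cancel_left zero_neq_numeral
          not_False_eq_True power_add simp_thms)
  qed
  have "fps_deriv (signed_necklace_fps m L) $ r =
      smult (real (Suc r) * ?s (Suc r)) (subst_neg_sq (necklace_poly m L (Suc r)))"
    by (simp add: signed_necklace_fps_def of_nat_poly mult.commute del: necklace_poly.simps)
  also have "\<dots> = smult (?s (Suc r) / real m)
      (\<Sum>j\<le>r. subst_neg_sq (cycle_poly m L (Suc j)) * subst_neg_sq (necklace_poly m L (r - j)))"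
  proof -
    have "real (Suc r) * ?s (Suc r) * (1 / (real m * real (Suc r))) = ?s (Suc r) / real m"
      by (simp del: of_nat_Suc)
    then show ?thesis
      by (simp only: subst_neg_sq_def necklace_poly.simps pcompose_smult pcompose_sum pcompose_mult smult_smult)
  qed
  also have "\<dots> = (\<Sum>j\<le>r. cycle_fps m L $ j * signed_necklace_fps m L $ (r - j))"
    unfolding smult_sum_right
  proof (rule sum.cong[OF refl])
    fix j assume "j \<in> {..r}"
    then have "j \<le> r" by simp
    then show "smult (?s (Suc r) / real m)
        (subst_neg_sq (cycle_poly m L (Suc j)) * subst_neg_sq (necklace_poly m L (r - j))) =
      cycle_fps m L $ j * signed_necklace_fps m L $ (r - j)"
      unfolding sgn[OF \<open>j \<le> r\<close>]
      by (simp add: cycle_fps_def signed_necklace_fps_def signed_cycle_poly_def mult_ac)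
  qed
  also have "\<dots> = (signed_necklace_fps m L * cycle_fps m L) $ r"
    by (simp add: mult.commute[of "signed_necklace_fps m L"] fps_mult_nth atMost_atLeast0)
  finally show "fps_deriv (signed_necklace_fps m L) $ r =
      (signed_necklace_fps m L * cycle_fps m L) $ r" .
qed

lemma signed_necklace_fps_0 [simp]: "signed_necklace_fps m L $ 0 = 1"
  by (simp add: signed_necklace_fps_def subst_neg_sq_def pcompose_1)

text \<open>The factor \<open>k + 1\<close> cancels in \<open>real poly\<close>, so the equation
  determines each coefficient from the earlier ones. It lets two series be compared through their
  logarithmic derivatives.\<close>

lemma fps_linear_ODE_unique:
  fixes P Q D :: "real poly fps"
  assumes P: "fps_deriv P = P * D" and Q: "fps_deriv Q = Q * D" and 0: "P $ 0 = Q $ 0"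
  shows "P = Q"
proof (rule fps_ext)
  fix n show "P $ n = Q $ n"
  proof (induction n rule: less_induct)
    case (less n)
    show ?case
    proof (cases n)
      case (Suc k)
      have "(P * D) $ k = (Q * D) $ k"
        unfolding fps_mult_nth using less Suc by (intro sum.cong) auto
      then have "fps_deriv P $ k = fps_deriv Q $ k" using P Q by simp
      then have "of_nat (k + 1) * P $ (k + 1) = of_nat (k + 1) * Q $ (k + 1)" by (simp only: fps_deriv_nth)
      moreover have "of_nat (k + 1) \<noteq> (0 :: real poly)" by (simp only: of_nat_eq_0_iff)
      ultimately have "P $ (k + 1) = Q $ (k + 1)" using mult_left_cancel by blast
      then show ?thesis using Suc by simp
    qed (simp add: 0)
  qed
qed

section \<open>The series \<open>2 / (1 - t^2)\<close> and the logarithmic derivative of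
  \<open>((1 + t) / (1 - t))^g\<close>\<close>

definition log_ratio_deriv :: "real fps" where
  "log_ratio_deriv = Abs_fps (\<lambda>j. if even j then 2 else 0)"

lemma deriv_log_ratio:
  "fps_deriv (fps_log ((1 + fps_X) / (1 - fps_X))) = log_ratio_deriv"
proof -
  define f :: "real fps" where "f = (1 + fps_X) / (1 - fps_X)"
  have nz: "(1 - fps_X :: real fps) \<noteq> 0" "(1 + fps_X :: real fps) \<noteq> 0"
    by (metis diff_0_right fps_X_nth fps_nonzero_nth fps_one_nth fps_sub_nth zero_neq_one,
        metis add_0_right fps_X_nth fps_add_nth fps_nonzero_nth fps_one_nth zero_neq_one)
  have f: "f * (1 - fps_X) = 1 + fps_X"
    unfolding f_def by (subst fps_divide_unit) (simp_all add: mult.assoc inverse_mult_eq_1)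
  have "(f * (1 - fps_X)) $ 0 = 1" unfolding f by simp
  then have f0: "f $ 0 = 1" by simp
  have "fps_deriv (f * (1 - fps_X)) = 1" unfolding f by simp
  then have df: "fps_deriv f * (1 - fps_X) = 1 + f" by (simp add: algebra_simps)
  have "fps_deriv (fps_log f) = (inverse (1 + fps_X) oo (f - 1)) * fps_deriv (f - 1)"
    unfolding fps_log_def by (subst fps_compose_deriv) (simp_all add: f0 fps_ln_deriv)
  also have "inverse (1 + fps_X) oo (f - 1) = inverse f"
    by (subst fps_inverse_compose) (simp_all add: f0 fps_compose_add_distrib)
  finally have d: "fps_deriv (fps_log f) = inverse f * fps_deriv f" by simp
  have inv: "inverse f * f = 1" by (rule inverse_mult_eq_1) (simp add: f0)
  \<comment> \<open>Writing \<open>1 + t\<close> as \<open>f * (1 - t)\<close> lets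
    \<open>inverse f\<close> cancel, and the remaining factors clear the denominator of
    \<open>f\<close>.\<close>
  have "fps_deriv (fps_log f) * ((1 - fps_X) * (1 + fps_X)) =
      inverse f * fps_deriv f * ((1 - fps_X) * (f * (1 - fps_X)))"
    by (simp only: d f)
  also have "\<dots> = (inverse f * f) * ((fps_deriv f * (1 - fps_X)) * (1 - fps_X))"
    by (simp only: mult_ac)
  also have "\<dots> = (1 - fps_X) + f * (1 - fps_X)"
    unfolding inv df by (simp add: algebra_simps)
  also have "\<dots> = 2" unfolding f by simp
  also have "(2 :: real fps) = log_ratio_deriv * (1 - fps_X\<^sup>2)"
  proof (rule fps_ext)
    fix n
    have "(2 :: real fps) $ n = (if n = 0 then 2 else 0)" by (simp add: fps_numeral_nth)
    then show "(2 :: real fps) $ n = (log_ratio_deriv * (1 - fps_X\<^sup>2)) $ n"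
      by (auto simp: log_ratio_deriv_def right_diff_distrib fps_X_power_mult_right_nth)
  qed
  also have "(1 - fps_X\<^sup>2 :: real fps) = (1 - fps_X) * (1 + fps_X)"
    by (simp add: algebra_simps power2_eq_square)
  finally show ?thesis using nz unfolding f_def by (simp only: mult_right_cancel mult_eq_0_iff simp_thms)
qed

lemma fps_lift_deriv: "fps_deriv (fps_lift f) = fps_lift (fps_deriv f)"
  by (rule fps_ext) (simp add: fps_lift_def of_nat_poly)

lemma ratio_pow_deriv:
  fixes g :: "real poly"
  defines "P \<equiv> fps_pow_poly ((1 + fps_X) / (1 - fps_X)) g"
  shows "fps_deriv P = P * (fps_const g * fps_lift log_ratio_deriv)" "P $ 0 = 1"
proof -
  let ?u = "fps_const g * fps_lift (fps_log ((1 + fps_X) / (1 - fps_X)))"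
  have u0: "?u $ 0 = 0" by (simp add: fps_lift_def fps_log_def)
  have "fps_deriv P = (fps_deriv (fps_lift (fps_exp 1)) oo ?u) * fps_deriv ?u"
    unfolding P_def fps_pow_poly_def by (rule fps_compose_deriv[OF u0])
  moreover have "fps_deriv ?u = fps_const g * fps_lift log_ratio_deriv"
    by (simp only: fps_deriv_mult_const_left fps_lift_deriv deriv_log_ratio)
  moreover have "fps_deriv (fps_lift (fps_exp 1)) = fps_lift (fps_exp 1)"
    by (simp add: fps_lift_deriv)
  ultimately show "fps_deriv P = P * (fps_const g * fps_lift log_ratio_deriv)"
    by (simp only: P_def fps_pow_poly_def)
  show "P $ 0 = 1" by (simp add: P_def fps_pow_poly_def fps_lift_def)
qed

text \<open>The logarithmic derivative is \<open>(q / m) / (1 - t^2)\<close>, that is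
  \<open>q / (2 m)\<close> times the derivative of \<open>log ((1 + t) / (1 - t))\<close>; this
  explains the factor \<open>1 / (2 * real m)\<close>.\<close>

lemma umbral_ratio_pow_eqI:
  assumes m: "even m" "m > 0"
    and C: "\<And>j. j > 0 \<Longrightarrow> signed_cycle_poly m L j = (if odd j then q else 0)"
  shows "umbral (signed_necklace_fps m L) = umbral_ratio_pow (smult (1 / (2 * real m)) q)"
proof -
  let ?g = "smult (1 / (2 * real m)) q"
  have "cycle_fps m L = fps_const ?g * fps_lift log_ratio_deriv"
    by (rule fps_ext) (simp add: cycle_fps_def C fps_lift_def log_ratio_deriv_def)
  then have "signed_necklace_fps m L = fps_pow_poly ((1 + fps_X) / (1 - fps_X)) ?g"
    using fps_linear_ODE_unique[OF signed_necklace_fps_deriv[OF m], of _ L] ratio_pow_deriv[of ?g]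
    by (simp only: signed_necklace_fps_0)
  then show ?thesis by (simp only: umbral_ratio_pow_def)
qed

text \<open>Pairing odd \<open>d\<close> with \<open>2 * d\<close> leaves a sum over
  \<open>d dvd h\<close>. For odd \<open>j\<close> the term of \<open>d\<close> is the monomial and
  that of \<open>2 * d\<close> a constant; for even \<open>j\<close> both are constants. The
  constants do not depend on \<open>d\<close>, so they meet the full Moebius sum over the divisors
  of \<open>h\<close> and survive only for \<open>h = 1\<close>.\<close>

lemma signed_cycle_poly_eq:
  assumes m: "m = 2 ^ k * h" and k: "k \<ge> 1" and h: "odd h" and L: "L = 1 \<or> L = -1"
  shows "signed_cycle_poly m L j = (if odd j
    then (\<Sum>d | d dvd h. smult (of_int (moebius d)) (monom 1 (m div d))) +
      [:if h = 1 then if k = 1 then L else - 1 else 0:]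
    else [:if h = 1 \<and> k = 1 then 1 - L else 0:])"
proof -
  have h0: "h > 0" using h by (auto intro: Nat.gr0I)
  have m0: "m > 0" and evm: "even m" using m k h0 by auto
  define s :: real where "s = (-1) ^ (m * j div 2)"
  define g :: "nat \<Rightarrow> real poly" where "g d = (if even (j * d) then [:s * L ^ (m div d):]
      else monom (s * (-1) ^ (m div d div 2)) (2 * (m div d div 2)))" for d
  have "signed_cycle_poly m L j = (\<Sum>d | d dvd m. smult (of_int (moebius d)) (g d))"
    unfolding signed_cycle_poly_def cycle_poly_def subst_neg_sq_def pcompose_sum smult_sum_right pcompose_smult
  proof (rule sum.cong[OF refl])
    fix d
    show "smult ((-1) ^ (m * j div 2)) (smult (of_int (moebius d))
        (pcompose (if even (j * d) then [:L ^ (m div d):] else monom 1 (m div d div 2)) [:0, 0, - 1:])) =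
      smult (of_int (moebius d)) (g d)"
      using subst_neg_sq_monom[of 1 "m div d div 2"]
      by (simp add: g_def s_def subst_neg_sq_def smult_monom pcompose_const)
  qed
  also have "\<dots> = (\<Sum>d | d dvd m. of_int (moebius d) * g d)"
    by (simp add: of_int_poly)
  also have "\<dots> = (\<Sum>d | d dvd m \<and> \<not> 2 dvd d. of_int (moebius d) * (g d - g (2 * d)))"
    by (rule sum_moebius_split[OF m0]) (use evm in auto)
  also have "{d. d dvd m \<and> \<not> 2 dvd d} = {d. d dvd h}"
  proof (intro Collect_cong iffI)
    fix d assume d: "d dvd m \<and> \<not> 2 dvd d"
    then have "coprime d (2 ^ k)" by (simp add: coprime_right_2_iff_odd)
    then show "d dvd h" using d m by (metis coprime_dvd_mult_right_iff)
  next
    fix d assume "d dvd h"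
    then show "d dvd m \<and> \<not> 2 dvd d" using h m by (meson dvd_mult dvd_trans)
  qed
  also have "(\<Sum>d | d dvd h. of_int (moebius d) * (g d - g (2 * d))) =
      (\<Sum>d | d dvd h. of_int (moebius d) *
        ((if odd j then monom 1 (m div d) else 0) + [:if odd j then if k = 1 then L else - 1
          else if k = 1 then 1 - L else 0:]))"
  proof (rule sum.cong[OF refl])
    fix d assume "d \<in> {d. d dvd h}"
    then obtain e where e: "h = d * e" by auto
    then have od: "odd d" "odd e" and d0: "d > 0" using h by (auto intro: Nat.gr0I)
    obtain k' where k': "k = Suc k'" using k by (cases k) auto
    have md: "m div d = 2 * (2 ^ k' * e)" and md2: "m div (2 * d) = 2 ^ k' * e"
      using d0 by (simp_all add: m e k' mult.left_commute[of d] mult.commute[of _ d])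
    have mj: "m * j div 2 = d * j * (2 ^ k' * e)" by (simp add: m e k')
    have L2: "L ^ (2 * n) = 1" for n using L by (auto simp: power_mult)
    \<comment> \<open>\<open>m div (2 * d)\<close> is odd exactly when \<open>k = 1\<close>; only
      then can the sign of \<open>L\<close> be felt.\<close>
    have Lm: "L ^ (2 ^ k' * e) = (if k = 1 then L else 1)"
      using L od by (auto simp: k' minus_one_power_iff)
    have sj: "s = (if odd j \<and> k = 1 then -1 else 1)"
      using od by (auto simp: s_def mj k' minus_one_power_iff)
    have "g d - g (2 * d) = (if odd j then monom 1 (m div d) else 0) +
        [:if odd j then if k = 1 then L else - 1 else if k = 1 then 1 - L else 0:]"
    proof (cases "odd j")
      case True
      \<comment> \<open>The exponent of \<open>s\<close> is \<open>d * j\<close> times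
        \<open>2 ^ k' * e\<close>. Since \<open>d\<close> and \<open>j\<close> are odd, both signs
        agree.\<close>
      have "s * (-1) ^ (2 ^ k' * e) = 1" using od True by (auto simp: sj k' minus_one_power_iff)
      then have "g d = monom 1 (m div d)" using True od by (simp add: g_def md)
      moreover have "g (2 * d) = [:- (if k = 1 then L else -1):]"
        using True by (simp add: g_def md2 Lm sj)
      ultimately show ?thesis using True by simp
    next
      case False
      then show ?thesis by (simp add: g_def md md2 Lm sj L2)
    qed
    then show "of_int (moebius d) * (g d - g (2 * d)) = of_int (moebius d) *
        ((if odd j then monom 1 (m div d) else 0) +
        [:if odd j then if k = 1 then L else - 1 else if k = 1 then 1 - L else 0:])" by simp
  qed
  also have "\<dots> = (\<Sum>d | d dvd h. of_int (moebius d) * (if odd j then monom 1 (m div d) else 0)) +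
      (\<Sum>d | d dvd h. of_int (moebius d)) *
        [:if odd j then if k = 1 then L else - 1 else if k = 1 then 1 - L else 0:]"
    by (simp only: distrib_left sum.distrib sum_distrib_right)
  finally show ?thesis
    unfolding sum_moebius[OF h0] by (simp add: of_int_poly)
qed

theorem theorem5p5:
  shows "(\<forall>m k h :: nat. m = 2 ^ k * h \<and> k \<ge> 1 \<and> h \<ge> 3 \<and> odd h \<longrightarrow>
            F_alt m = F_rev m \<and>
            F_alt m = umbral_ratio_pow
              (smult (1 / (2 * real m))
                (\<Sum>d | d dvd h. smult (of_int (moebius d)) (monom 1 (m div d)))))
       \<and> (\<forall>m k :: nat. m = 2 ^ k \<and> k \<ge> 2 \<longrightarrow>
            F_alt m = F_rev m \<and>
            F_alt m = umbral_ratio_pow (smult (1 / (2 * real m)) (monom 1 m - 1)))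
       \<and> F_alt 2 = umbral_ratio_pow (smult (1 / 4) (monom 1 2 + 1))
       \<and> F_rev 2 = F_alt 2 / (1 + fps_X)"
proof (intro conjI allI impI)
  fix m k h :: nat
  assume a: "m = 2 ^ k * h \<and> k \<ge> 1 \<and> h \<ge> 3 \<and> odd h"
  let ?q = "\<Sum>d | d dvd h. smult (of_int (moebius d)) (monom 1 (m div d))"
  have m: "even m" "m > 0" using a by (auto intro: Nat.gr0I)
  have C: "signed_cycle_poly m L j = (if odd j then ?q else 0)" if "L = 1 \<or> L = -1" for L j
    using signed_cycle_poly_eq[of m k h L j] a that by auto
  have U: "umbral (signed_necklace_fps m L) = umbral_ratio_pow (smult (1 / (2 * real m)) ?q)"
    if "L = 1 \<or> L = -1" for L
    by (rule umbral_ratio_pow_eqI[OF m]) (rule C[OF that])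
  show "F_alt m = F_rev m" "F_alt m = umbral_ratio_pow (smult (1 / (2 * real m)) ?q)"
    using U[of 1] U[of "-1"] by (simp_all add: F_alt_umbral[OF m] F_rev_umbral[OF m])
next
  fix m k :: nat
  assume a: "m = 2 ^ k \<and> k \<ge> 2"
  have m: "even m" "m > 0" using a by auto
  have C: "signed_cycle_poly m L j = (if odd j then monom 1 m - 1 else 0)" if "L = 1 \<or> L = -1" for L j
    using signed_cycle_poly_eq[of m k 1 L j] a that by (simp add: moebius_def one_pCons)
  have U: "umbral (signed_necklace_fps m L) = umbral_ratio_pow (smult (1 / (2 * real m)) (monom 1 m - 1))"
    if "L = 1 \<or> L = -1" for L
    by (rule umbral_ratio_pow_eqI[OF m]) (rule C[OF that])
  show "F_alt m = F_rev m" "F_alt m = umbral_ratio_pow (smult (1 / (2 * real m)) (monom 1 m - 1))"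
    using U[of 1] U[of "-1"] by (simp_all add: F_alt_umbral[OF m] F_rev_umbral[OF m])
next
  have m: "even (2::nat)" "2 > (0::nat)" by auto
  have C: "signed_cycle_poly 2 L j = (if odd j then monom 1 2 + [:L:] else [:1 - L:])"
    if "L = 1 \<or> L = -1" for L j
    using signed_cycle_poly_eq[of 2 1 1 L j] that by (simp add: moebius_def)
  have "umbral (signed_necklace_fps 2 1) = umbral_ratio_pow (smult (1 / (2 * real 2)) (monom 1 2 + 1))"
    by (rule umbral_ratio_pow_eqI[OF m]) (simp add: C one_pCons)
  then show "F_alt 2 = umbral_ratio_pow (smult (1 / 4) (monom 1 2 + 1))"
    by (simp add: F_alt_umbral[OF m])
  have monom2: "monom 1 2 = [:0, 0, 1 :: real:]" by (simp add: monom_altdef power2_eq_square)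
  let ?R = "signed_necklace_fps 2 (-1)"
  \<comment> \<open>The logarithmic derivatives for \<open>L = 1\<close> and \<open>L = -1\<close>
    differ by 1 at even and by -1 at odd powers of \<open>t\<close>, hence by
    \<open>1 / (1 + t)\<close>, the logarithmic derivative of \<open>1 + t\<close>. The identity is
    stated with the denominator cleared.\<close>
  have D: "cycle_fps 2 (-1) * (1 + fps_X) + 1 = cycle_fps 2 1 * (1 + fps_X)"
  proof (rule fps_ext)
    fix n
    show "(cycle_fps 2 (-1) * (1 + fps_X) + 1) $ n = (cycle_fps 2 1 * (1 + fps_X)) $ n"
      by (cases n) (simp_all add: cycle_fps_def C distrib_left one_pCons monom2)
  qed
  have "?R * (1 + fps_X) = signed_necklace_fps 2 1"
  proof (rule fps_linear_ODE_unique)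
    have "fps_deriv (?R * (1 + fps_X)) = ?R * (cycle_fps 2 (-1) * (1 + fps_X) + 1)"
      by (simp add: signed_necklace_fps_deriv[OF m] algebra_simps)
    then show "fps_deriv (?R * (1 + fps_X)) = ?R * (1 + fps_X) * cycle_fps 2 1"
      unfolding D by (simp add: mult_ac)
    show "fps_deriv (signed_necklace_fps 2 1) = signed_necklace_fps 2 1 * cycle_fps 2 1"
      by (rule signed_necklace_fps_deriv[OF m])
  qed simp
  \<comment> \<open>This product passes through umbral evaluation because \<open>1 + t\<close> does
    not involve \<open>E\<close>, so linearity suffices.\<close>
  moreover have "umbral (?R * (1 + fps_X)) = umbral ?R * (1 + fps_X)"
    by (rule fps_ext) (simp add: umbral_def distrib_left umbral_eval_add)
  ultimately have "F_alt 2 = F_rev 2 * (1 + fps_X)"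
    by (simp add: F_alt_umbral[OF m] F_rev_umbral[OF m])
  moreover have "(1 + fps_X :: real fps) \<noteq> 0"
    by (metis add_0_right fps_X_nth fps_add_nth fps_nonzero_nth fps_one_nth zero_neq_one)
  ultimately show "F_rev 2 = F_alt 2 / (1 + fps_X)" by simp
qed

end
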